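(* Let $q>0$ and let $L_0$, $T_{m_0}$ be constants with $L_0>T_{m_0}$. There exists a unique solution $(T,S)$ to the Stefan problem $$T_t=T_{yy},\quad 0<y<S(t),\ t>0,$$ $$-T_y(S(t),t)=L_0\sqrt t\,\dot S(t),\quad t>0,$$ $$T(S(t),t)=T_{m_0}\sqrt t,\quad t>0,$$ $$T_y(0,t)=-q,\quad t>0,$$ $$S(0)=0,$$ which is given by $$T(y,t)=\frac{q-L_0\gamma}{\sqrt\pi\,\mathrm{erf}\,\gamma}\left(2\sqrt t\,e^{-\frac{y^2}{4t}}+\sqrt\pi\,y\,\mathrm{erf}\frac{y}{2\sqrt t}\right)-qy,\quad 0<y<S(t),\ t>0,$$ and $$S(t)=2\gamma\sqrt t,$$ where $\gamma>0$ is the unique solution to $$\frac{T_{m_0}/2+q\gamma}{e^{-\gamma^2}+\sqrt\pi\,\gamma\,\mathrm{erf}\,\gamma}=\frac{q-L_0\gamma}{\sqrt\pi\,\mathrm{erf}\,\gamma}.$$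
   Context: Subscripts denote partial derivatives, a dot denotes $d/dt$, and $\mathrm{erf}(x)=\frac{2}{\sqrt\pi}\int_0^xe^{-s^2}ds$.
   Formalization: L_0>0 is assumed in addition: if T_{m_0}<L_0≤0 the equation for γ has no positive solution. "Solution" means a classical one with S>0 for t>0 and T continuous on 0≤y≤S(t), t≥0, including the corner (0,0). *)

theory Defs
  imports "HOL-Analysis.Analysis"
begin

definition erf :: "real \<Rightarrow> real" where
  "erf x = 2 / sqrt pi * (LBINT s=0..x. exp (- s\<^sup>2))"

text \<open>
  Classical solutions of the Stefan problem.  \<open>T y t\<close> is only constrained on the closed
  region \<open>0 \<le> y \<le> S t\<close>, \<open>t \<ge> 0\<close>.  Regularity: \<open>T\<close> is continuous on that region
  (including the corner \<open>(0,0)\<close>, where the front starts), \<open>T\<^sub>y\<close> exists and is continuous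
  up to the lateral boundaries \<open>y = 0\<close> and \<open>y = S t\<close> for \<open>t > 0\<close> (one-sided there),
  and \<open>T\<^sub>t\<close>, \<open>T\<^sub>y\<^sub>y\<close> are continuous in the interior.  Continuity at the corner serves
  as the initial condition: without it a point source of heat released at \<open>(0,0)\<close> is not
  excluded by the equations.
\<close>
definition stefan_solution ::
  "real \<Rightarrow> real \<Rightarrow> real \<Rightarrow> (real \<Rightarrow> real \<Rightarrow> real) \<Rightarrow> (real \<Rightarrow> real) \<Rightarrow> bool" where
  "stefan_solution q L0 Tm0 T S \<longleftrightarrow>
     continuous_on {0..} S \<and>
     (\<forall>t>0. S t > 0 \<and> S differentiable (at t)) \<and>
     continuous_on {(y, t). 0 \<le> t \<and> 0 \<le> y \<and> y \<le> S t} (\<lambda>(y, t). T y t) \<and>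
     (\<exists>Ty Tyy Tt.
        continuous_on {(y, t). 0 < t \<and> 0 \<le> y \<and> y \<le> S t} (\<lambda>(y, t). Ty y t) \<and>
        continuous_on {(y, t). 0 < t \<and> 0 < y \<and> y < S t} (\<lambda>(y, t). Tyy y t) \<and>
        continuous_on {(y, t). 0 < t \<and> 0 < y \<and> y < S t} (\<lambda>(y, t). Tt y t) \<and>
        (\<forall>t>0. \<forall>y\<in>{0..S t}. ((\<lambda>x. T x t) has_real_derivative Ty y t) (at y within {0..S t})) \<and>
        (\<forall>t>0. \<forall>y\<in>{0<..<S t}. ((\<lambda>x. Ty x t) has_real_derivative Tyy y t) (at y)) \<and>
        (\<forall>t>0. \<forall>y\<in>{0<..<S t}. ((\<lambda>s. T y s) has_real_derivative Tt y t) (at t)) \<and>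
        (\<forall>t>0. \<forall>y\<in>{0<..<S t}. Tt y t = Tyy y t) \<and>
        (\<forall>t>0. - Ty (S t) t = L0 * sqrt t * deriv S t) \<and>
        (\<forall>t>0. T (S t) t = Tm0 * sqrt t) \<and>
        (\<forall>t>0. Ty 0 t = - q) \<and>
        S 0 = 0)"

definition gamma_eq :: "real \<Rightarrow> real \<Rightarrow> real \<Rightarrow> real \<Rightarrow> bool" where
  "gamma_eq q L0 Tm0 \<gamma> \<longleftrightarrow>
     (Tm0 / 2 + q * \<gamma>) / (exp (- \<gamma>\<^sup>2) + sqrt pi * \<gamma> * erf \<gamma>) =
     (q - L0 * \<gamma>) / (sqrt pi * erf \<gamma>)"

definition explicit_T :: "real \<Rightarrow> real \<Rightarrow> real \<Rightarrow> real \<Rightarrow> real \<Rightarrow> real" where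
  "explicit_T q L0 \<gamma> y t =
     (q - L0 * \<gamma>) / (sqrt pi * erf \<gamma>) *
       (2 * sqrt t * exp (- (y\<^sup>2 / (4 * t))) + sqrt pi * y * erf (y / (2 * sqrt t))) - q * y"

definition explicit_S :: "real \<Rightarrow> real \<Rightarrow> real" where
  "explicit_S \<gamma> t = 2 * \<gamma> * sqrt t"

end

theory Submission
  imports Defs
begin

text \<open>
  Any classical solution is trapped between barriers, i.e. strict super- and subsolutions of the
  free boundary problem.  Self-similar heat solutions of flux \<open>q\<close> whose front sits at
  \<open>2 g \<surd>t\<close> violate the Stefan condition with a definite sign for \<open>g > \<gamma>\<close> and
  \<open>g < \<gamma>\<close>.  Letting \<open>g\<close> drift slowly (linearly in \<open>ln t\<close>) towards \<open>\<gamma>\<close> keeps them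
  strict barriers, because the error made in the heat equation is absorbed by a small multiple
  of \<open>\<surd>t\<close>.  As the problem can be started at an arbitrarily small time, where a crude bound on
  the solution suffices, \<open>S(t) = 2 \<gamma> \<surd>t\<close> follows; on this known domain the temperature is
  determined by the minimum principle.
\<close>

section \<open>Self-similar heat profiles\<close>

text \<open>The equations are invariant under the scaling y -> l y, t -> l^2 t, T -> l T, so what
  matters is S / sqrt t and T / sqrt t, and a coefficient that is linear in ln t causes the same
  relative error at all times. An earlier start gives the drift more logarithmic time, so it may be
  as slow as desired. The price is that the start requires bounds on S / sqrt t and T / sqrt t
  uniform as t -> 0, while continuity at the corner only says that S and T tend to 0. From above,
  the gap is closed by translating an exact profile by \<delta> in space, which leaves room at the
  corner for each \<delta> > 0, and letting \<delta> -> 0. The translation disturbs the flux at y =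
  0, with the right sign only if the amplitude is nonnegative; hence the separate treatment of Tm0
  <= 0 in the upper bound. From below, positivity of S and a multiple of sqrt t suffice. The upper
  bound on the front comes first because a lower barrier also needs a bound on S / sqrt t to control
  its error in the heat equation.\<close>

lemma erf_has_real_derivative: "(erf has_real_derivative 2 / sqrt pi * exp (- x\<^sup>2)) (at x)"
proof -
  have "((\<lambda>u. LBINT s=0..u. exp (- s\<^sup>2)) has_vector_derivative exp (- x\<^sup>2))
      (at x within {- \<bar>x\<bar> - 1..\<bar>x\<bar> + 1})"
    unfolding zero_ereal_def by (rule interval_integral_FTC2) (auto intro!: continuous_intros)
  then have "((\<lambda>u. LBINT s=0..u. exp (- s\<^sup>2)) has_real_derivative exp (- x\<^sup>2)) (at x)"
    by (simp add: has_real_derivative_iff_has_vector_derivative at_within_Icc_at zero_ereal_def)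
  from DERIV_cmult[OF this, of "2 / sqrt pi"] show ?thesis
    by (simp add: erf_def[abs_def])
qed

text \<open>The unnormalised error function, twice the integral of exp(-s^2) from 0 to x; this
  scaling removes \<open>sqrt pi\<close> from all derivatives below.\<close>

definition serf :: "real \<Rightarrow> real" where
  "serf x = sqrt pi * erf x"

lemma serf_has_real_derivative: "(serf has_real_derivative 2 * exp (- x\<^sup>2)) (at x)"
  using DERIV_cmult[OF erf_has_real_derivative, of "sqrt pi" x] by (simp add: serf_def[abs_def])

lemmas DERIV_serf [derivative_intros] = DERIV_chain2[OF serf_has_real_derivative]

lemma continuous_on_serf [continuous_intros]:
  "continuous_on A f \<Longrightarrow> continuous_on A (\<lambda>x. serf (f x))"
  using continuous_on_compose2[of UNIV serf A f] serf_has_real_derivative DERIV_isCont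
  by (metis continuous_at_imp_continuous_on subset_UNIV)

lemma serf_0 [simp]: "serf 0 = 0"
  by (simp add: serf_def erf_def zero_ereal_def[symmetric])

lemma serf_strict_mono: "x < y \<Longrightarrow> serf x < serf y"
  by (rule DERIV_pos_imp_increasing[of x y serf]) (auto intro!: exI serf_has_real_derivative)

lemma serf_mono: "x \<le> y \<Longrightarrow> serf x \<le> serf y"
  using serf_strict_mono[of x y] by (cases "x = y") auto

lemma serf_pos: "0 < x \<Longrightarrow> 0 < serf x"
  using serf_strict_mono[of 0 x] by simp

lemma serf_minus [simp]: "serf (- x) = - serf x"
proof -
  have "((\<lambda>x. serf x + serf (- x)) has_real_derivative 0) (at x)" for x
    by (rule derivative_eq_intros refl | simp)+
  from DERIV_isconst_all[of "\<lambda>x. serf x + serf (- x)" x 0] this show ?thesis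
    by simp
qed

lemma serf_le: "0 \<le> x \<Longrightarrow> serf x \<le> 2 * x"
proof (cases "x = 0")
  case False
  assume "0 \<le> x"
  have "\<exists>z. 0 < z \<and> z < x \<and> serf x - serf 0 = (x - 0) * (2 * exp (- z\<^sup>2))"
    using False \<open>0 \<le> x\<close> by (intro MVT2) (auto intro: serf_has_real_derivative)
  then obtain z where "serf x = x * (2 * exp (- z\<^sup>2))" by auto
  moreover have "exp (- z\<^sup>2) \<le> 1" by simp
  ultimately show ?thesis
    using mult_left_mono[of "exp (- z\<^sup>2)" 1 "2 * x"] \<open>0 \<le> x\<close> by (simp add: mult_ac)
qed simp

lemma serf_ge:
  assumes "0 \<le> x" shows "2 * x * exp (- x\<^sup>2) \<le> serf x"
proof (cases "x = 0")
  case False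
  have "\<exists>z. 0 < z \<and> z < x \<and> serf x - serf 0 = (x - 0) * (2 * exp (- z\<^sup>2))"
    using False assms by (intro MVT2) (auto intro: serf_has_real_derivative)
  then obtain z where "0 < z" "z < x" "serf x = x * (2 * exp (- z\<^sup>2))" by auto
  moreover have "exp (- x\<^sup>2) \<le> exp (- z\<^sup>2)"
    using \<open>0 < z\<close> \<open>z < x\<close> by (simp add: power_mono)
  ultimately show ?thesis
    using mult_left_mono[of "exp (- x\<^sup>2)" "exp (- z\<^sup>2)" "2 * x"] assms by (simp add: mult_ac)
qed simp

text \<open>The antiderivative of \<open>serf\<close> with value 1 at 0. It is even and at least 1,
  so division by it is harmless, also at the negative arguments that arise below.\<close>

definition heat_profile :: "real \<Rightarrow> real" where
  "heat_profile x = exp (- x\<^sup>2) + x * serf x"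

lemma heat_profile_has_real_derivative: "(heat_profile has_real_derivative serf x) (at x)"
  unfolding heat_profile_def[abs_def] by (rule derivative_eq_intros refl | simp)+

lemmas DERIV_heat_profile [derivative_intros] = DERIV_chain2[OF heat_profile_has_real_derivative]

lemma continuous_on_heat_profile [continuous_intros]:
  "continuous_on A f \<Longrightarrow> continuous_on A (\<lambda>x. heat_profile (f x))"
  unfolding heat_profile_def by (intro continuous_intros)

lemma heat_profile_0 [simp]: "heat_profile 0 = 1"
  by (simp add: heat_profile_def)

lemma heat_profile_minus [simp]: "heat_profile (- x) = heat_profile x"
  by (simp add: heat_profile_def)

lemma heat_profile_mono:
  assumes "0 \<le> x" "x \<le> y" shows "heat_profile x \<le> heat_profile y"
proof (rule DERIV_nonneg_imp_nondecreasing[OF \<open>x \<le> y\<close>])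
  fix z assume "x \<le> z" "z \<le> y"
  then show "\<exists>d. (heat_profile has_real_derivative d) (at z) \<and> 0 \<le> d"
    using heat_profile_has_real_derivative serf_mono[of 0 z] assms by auto
qed

lemma heat_profile_abs [simp]: "heat_profile \<bar>x\<bar> = heat_profile x"
  by (simp add: abs_if)

lemma heat_profile_ge_1: "1 \<le> heat_profile x"
  using heat_profile_mono[of 0 "\<bar>x\<bar>"] by simp

lemma heat_profile_pos [simp]: "0 < heat_profile x"
  using heat_profile_ge_1[of x] by linarith

lemma heat_profile_nonneg [simp]: "0 \<le> heat_profile x"
  by (rule less_imp_le) simp

text \<open>Up to 1 the bound \<open>serf x \<le> 2 * x\<close> suffices; beyond 1 the summand
  \<open>x * serf x\<close> of the profile dominates. The ratio
  \<open>serf g / heat_profile g\<close> enters every slope, and this makes the later constants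
  uniform in g.\<close>

lemma abs_serf_le_heat_profile: "\<bar>serf x\<bar> \<le> 2 * heat_profile x"
proof -
  have *: "serf x \<le> 2 * heat_profile x" if "0 \<le> x" for x
  proof (cases "x \<le> 1")
    case True
    then show ?thesis using serf_le[OF that] heat_profile_ge_1[of x] by linarith
  next
    case False
    have "0 \<le> serf x" using serf_mono[OF that] by simp
    then have "serf x \<le> x * serf x" using False by (simp add: mult_le_cancel_right1)
    then have "serf x \<le> heat_profile x"
      unfolding heat_profile_def using exp_ge_zero[of "- x\<^sup>2"] by linarith
    then show ?thesis using heat_profile_pos[of x] by linarith
  qed
  show ?thesis
    using *[of x] *[of "- x"] serf_mono[of 0 x] serf_mono[of x 0] by (cases "0 \<le> x") auto
qed

text \<open>The even solution of the heat equation with initial trace sqrt pi * |y|; it has no flux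
  through y = 0. At t = 0 the formula gives 0, which agrees with that trace only at y = 0.\<close>

definition heat :: "real \<Rightarrow> real \<Rightarrow> real" where
  "heat y t = 2 * sqrt t * heat_profile (y / (2 * sqrt t))"

lemma heat_deriv_space:
  "0 < t \<Longrightarrow> ((\<lambda>y. heat y t) has_real_derivative serf (y / (2 * sqrt t))) (at y)"
  unfolding heat_def by (rule derivative_eq_intros refl | simp)+

lemma heat_deriv_space2:
  "0 < t \<Longrightarrow> ((\<lambda>y. serf (y / (2 * sqrt t))) has_real_derivative exp (- (y / (2 * sqrt t))\<^sup>2) / sqrt t) (at y)"
  by (rule derivative_eq_intros refl | simp add: real_div_sqrt field_simps)+

lemma heat_deriv_time:
  assumes "0 < t"
  shows "((\<lambda>t. heat y t) has_real_derivative exp (- (y / (2 * sqrt t))\<^sup>2) / sqrt t) (at t)"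
proof -
  have t: "t = sqrt t * sqrt t" using assms by simp
  have "((\<lambda>t. heat y t) has_real_derivative
      2 * sqrt t * (serf (y / (2 * sqrt t)) * (- y * (2 * (inverse (sqrt t) / 2)) / (2 * sqrt t * (2 * sqrt t))))
      + 2 * (inverse (sqrt t) / 2) * heat_profile (y / (2 * sqrt t))) (at t)"
    unfolding heat_def
    using assms by (auto intro!: derivative_eq_intros)
  then show ?thesis
    by (rule DERIV_cong) (use assms in \<open>simp add: heat_profile_def field_simps\<close>)
qed

lemmas DERIV_heat_space [derivative_intros] = DERIV_chain2[OF heat_deriv_space]
lemmas DERIV_heat_time [derivative_intros] = DERIV_chain2[OF heat_deriv_time]

lemma continuous_on_heat [continuous_intros]:
  assumes "continuous_on A f" "continuous_on A g" "\<And>x. x \<in> A \<Longrightarrow> 0 < g x"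
  shows "continuous_on A (\<lambda>x. heat (f x) (g x))"
  unfolding heat_def using assms(1,2) by (intro continuous_intros) (use assms(3) in force)+

lemma heat_nonneg: "0 \<le> t \<Longrightarrow> 0 \<le> heat y t"
  unfolding heat_def by (intro mult_nonneg_nonneg less_imp_le[OF heat_profile_pos]) auto

text \<open>
  The self-similar temperature with flux \<open>q\<close> at \<open>y = 0\<close> and value \<open>\<tau> \<surd>t\<close> at \<open>y = 2 g \<surd>t\<close> is
  \<open>amp q \<tau> g * heat y t - q * y\<close>; its flux through \<open>y = 2 g \<surd>t\<close> is \<open>slope q \<tau> g\<close>.
\<close>
definition amp :: "real \<Rightarrow> real \<Rightarrow> real \<Rightarrow> real" where
  "amp q \<tau> g = (\<tau> / 2 + q * g) / heat_profile g"

definition slope :: "real \<Rightarrow> real \<Rightarrow> real \<Rightarrow> real" where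
  "slope q \<tau> g = q - amp q \<tau> g * serf g"

lemma heat_profile_neq_0 [simp]: "heat_profile x \<noteq> 0"
  using heat_profile_pos[of x] by linarith

lemma amp_times_heat_profile: "amp q \<tau> g * heat_profile g = \<tau> / 2 + q * g"
  by (simp add: amp_def)

text \<open>This is why the error that a drifting g makes in the heat equation is governed by
  \<open>slope\<close>, a quantity bounded uniformly in g.\<close>

lemma amp_has_real_derivative: "(amp q \<tau> has_real_derivative slope q \<tau> g / heat_profile g) (at g)"
  unfolding amp_def[abs_def] slope_def
  by (auto intro!: derivative_eq_intros simp: field_simps)

lemma continuous_on_amp [continuous_intros]:
  "continuous_on A f \<Longrightarrow> continuous_on A (\<lambda>x. amp q \<tau> (f x))"
  unfolding amp_def by (intro continuous_intros) auto

text \<open>The terms q * g * serf g cancel, so the sign of the slope can be read off from \<tau>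
  and the sign of g.\<close>

lemma slope_eq: "slope q \<tau> g = (q * exp (- g\<^sup>2) - \<tau> / 2 * serf g) / heat_profile g"
proof -
  have "slope q \<tau> g * heat_profile g = q * heat_profile g - amp q \<tau> g * heat_profile g * serf g"
    by (simp add: slope_def algebra_simps)
  also have "\<dots> = q * exp (- g\<^sup>2) - \<tau> / 2 * serf g"
    unfolding amp_times_heat_profile by (simp add: heat_profile_def algebra_simps)
  finally show ?thesis by (simp add: field_simps)
qed

text \<open>A barrier has its prescribed value at its own front; monotonicity of the profile turns
  this into an inequality at the true front, which lies elsewhere.\<close>

lemma profile_antimono:
  assumes "a \<le> b" "\<And>x. a \<le> x \<Longrightarrow> x \<le> b \<Longrightarrow> c * serf x \<le> q"
  shows "c * heat_profile b - q * b \<le> c * heat_profile a - q * a"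
proof (rule DERIV_nonpos_imp_nonincreasing[OF assms(1), where f = "\<lambda>x. c * heat_profile x - q * x"])
  fix x assume "a \<le> x" "x \<le> b"
  then show "\<exists>D. ((\<lambda>x. c * heat_profile x - q * x) has_real_derivative D) (at x) \<and> D \<le> 0"
    using assms(2)[of x]
    by (intro exI[of _ "c * serf x - q"]) (auto intro!: derivative_eq_intros)
qed

lemma profile_scaling:
  "0 < t \<Longrightarrow> c * heat y t - q * y =
    2 * sqrt t * (c * heat_profile (y / (2 * sqrt t)) - q * (y / (2 * sqrt t)))"
  by (simp add: heat_def field_simps)

lemma profile_at_front:
  "0 < t \<Longrightarrow> amp q \<tau> g * heat (2 * g * sqrt t) t - q * (2 * g * sqrt t) = \<tau> * sqrt t"
  by (simp add: profile_scaling amp_times_heat_profile)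

section \<open>A minimum principle on moving domains\<close>

lemma compact_moving_region:
  fixes S :: "real \<Rightarrow> real"
  assumes "continuous_on {a..b} S" "\<And>t. t \<in> {a..b} \<Longrightarrow> 0 \<le> S t"
  shows "compact {(y, t). a \<le> t \<and> t \<le> b \<and> 0 \<le> y \<and> y \<le> S t}"
proof -
  have eq: "{(y, t). a \<le> t \<and> t \<le> b \<and> 0 \<le> y \<and> y \<le> S t} =
      (\<lambda>(x, t). (x * S t, t)) ` ({0..1} \<times> {a..b})" (is "?L = ?R")
  proof
    show "?L \<subseteq> ?R"
    proof clarify
      fix y t assume *: "a \<le> t" "t \<le> b" "0 \<le> y" "y \<le> S t"
      show "(y, t) \<in> ?R"
        \<comment> \<open>If S t = 0 then y = 0, and y / S t = 0 by the convention for division by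
          zero, so the witness is still right.\<close>
        using * by (intro image_eqI[of _ _ "(y / S t, t)"]) (auto simp: divide_simps)
    qed
    show "?R \<subseteq> ?L"
      using assms(2) by (auto simp: mult_left_le_one_le)
  qed
  have "continuous_on ({0..1} \<times> {a..b}) (\<lambda>p. S (snd p))"
    by (rule continuous_on_compose2[OF assms(1)]) (auto intro!: continuous_intros)
  then show ?thesis
    unfolding eq
    by (intro compact_continuous_image compact_Times)
       (auto intro!: continuous_intros simp: case_prod_unfold)
qed

section \<open>Derivative tests at a minimum, one-sided in time and at the ends of the space
  interval\<close>

lemma second_derivative_nonneg_at_min:
  fixes f f' :: "real \<Rightarrow> real"
  assumes "a < x" "x < b"
    and f: "\<And>y. a < y \<Longrightarrow> y < b \<Longrightarrow> (f has_real_derivative f' y) (at y)"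
    and f': "(f' has_real_derivative D) (at x)"
    and min: "\<And>y. a < y \<Longrightarrow> y < b \<Longrightarrow> f x \<le> f y"
  shows "0 \<le> D"
proof (rule ccontr)
  assume "\<not> 0 \<le> D"
  have "f' x = 0"
    using assms(1,2)
    by (intro DERIV_local_min[OF f[OF assms(1,2)], of "min (x - a) (b - x)"])
       (auto intro!: min simp: abs_if split: if_splits)
  obtain d where d: "0 < d" "\<And>h. 0 < h \<Longrightarrow> h < d \<Longrightarrow> f' (x + h) < f' x"
    using DERIV_neg_dec_right[OF f'] \<open>\<not> 0 \<le> D\<close> by auto
  define h where "h = min d (b - x) / 2"
  have h: "0 < h" "h < d" "x + h < b"
    using d(1) assms(2) by (auto simp: h_def min_def field_simps)
  have "\<exists>z. x < z \<and> z < x + h \<and> f (x + h) - f x = (x + h - x) * f' z"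
    using h assms(1) by (intro MVT2) (auto intro: f)
  then obtain z where z: "x < z" "z < x + h" "f (x + h) - f x = h * f' z" by auto
  have "f' z < 0"
    using d(2)[of "z - x"] z h \<open>f' x = 0\<close> by simp
  then have "f (x + h) < f x"
    using z(3) h(1) by (smt (verit) mult_pos_neg)
  with min[of "x + h"] h assms(1) show False by simp
qed

lemma derivative_nonpos_at_left_min:
  fixes f :: "real \<Rightarrow> real"
  assumes f: "(f has_real_derivative D) (at t)" and "a < t"
    and min: "\<And>s. a < s \<Longrightarrow> s < t \<Longrightarrow> f t \<le> f s"
  shows "D \<le> 0"
proof (rule ccontr)
  assume "\<not> D \<le> 0"
  then obtain d where d: "0 < d" "\<And>h. 0 < h \<Longrightarrow> h < d \<Longrightarrow> f (t - h) < f t"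
    using DERIV_pos_inc_left[OF f] by auto
  define h where "h = min d (t - a) / 2"
  have h: "0 < h" "h < d" "a < t - h"
    using d(1) assms(2) by (auto simp: h_def min_def field_simps)
  with d(2)[of h] min[of "t - h"] show False by simp
qed

lemma derivative_at_left_endpoint_min:
  fixes f :: "real \<Rightarrow> real"
  assumes f: "(f has_real_derivative D) (at a within {a..b})" and "a < b"
    and min: "\<And>x. x \<in> {a..b} \<Longrightarrow> f a \<le> f x"
  shows "0 \<le> D"
proof (rule ccontr)
  assume "\<not> 0 \<le> D"
  then obtain d where d: "0 < d" "\<And>h. 0 < h \<Longrightarrow> a + h \<in> {a..b} \<Longrightarrow> h < d \<Longrightarrow> f (a + h) < f a"
    using has_real_derivative_neg_dec_right[OF f] by auto
  define h where "h = min d (b - a) / 2"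
  have h: "0 < h" "h < d" "a + h < b"
    using d(1) assms(2) by (auto simp: h_def min_def field_simps)
  with d(2)[of h] min[of "a + h"] show False by simp
qed

lemma derivative_at_right_endpoint_min:
  fixes f :: "real \<Rightarrow> real"
  assumes f: "(f has_real_derivative D) (at b within {a..b})" and "a < b"
    and min: "\<And>x. x \<in> {a..b} \<Longrightarrow> f b \<le> f x"
  shows "D \<le> 0"
proof (rule ccontr)
  assume "\<not> D \<le> 0"
  then obtain d where d: "0 < d" "\<And>h. 0 < h \<Longrightarrow> b - h \<in> {a..b} \<Longrightarrow> h < d \<Longrightarrow> f (b - h) < f b"
    using has_real_derivative_pos_inc_left[OF f] by auto
  define h where "h = min d (b - a) / 2"
  have h: "0 < h" "h < d" "a < b - h"
    using d(1) assms(2) by (auto simp: h_def min_def field_simps)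
  with d(2)[of h] min[of "b - h"] show False by simp
qed

text \<open>The heat inequality and the flux condition are weak. Adding e * ((t - a) + (Y - y))
  makes both strict at once: the time part adds e to the time derivative, the space part subtracts e
  from the flux derivative at y = 0 and, being linear in y, leaves the second derivative unchanged.
  With Y above the front the added term is nonnegative, so the initial and lateral conditions
  survive.\<close>

lemma parabolic_minimum_principle:
  fixes S :: "real \<Rightarrow> real" and w :: "real \<Rightarrow> real \<Rightarrow> real"
  assumes S_cont: "continuous_on {a..b} S"
    and S_pos: "\<And>t. a \<le> t \<Longrightarrow> t \<le> b \<Longrightarrow> 0 < S t"
    and w_cont: "continuous_on {(y, t). a \<le> t \<and> t \<le> b \<and> 0 \<le> y \<and> y \<le> S t} (\<lambda>(y, t). w y t)"
    and init: "\<And>y. 0 \<le> y \<Longrightarrow> y \<le> S a \<Longrightarrow> 0 \<le> w y a"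
    and lateral: "\<And>t. a < t \<Longrightarrow> t \<le> b \<Longrightarrow> 0 \<le> w (S t) t"
    and flux: "\<And>t. a < t \<Longrightarrow> t \<le> b \<Longrightarrow>
      \<exists>D\<le>0. ((\<lambda>y. w y t) has_real_derivative D) (at 0 within {0..S t})"
    and space: "\<And>y t. a < t \<Longrightarrow> t \<le> b \<Longrightarrow> 0 < y \<Longrightarrow> y < S t \<Longrightarrow>
      ((\<lambda>y. w y t) has_real_derivative wy y t) (at y)"
    and space2: "\<And>y t. a < t \<Longrightarrow> t \<le> b \<Longrightarrow> 0 < y \<Longrightarrow> y < S t \<Longrightarrow>
      ((\<lambda>y. wy y t) has_real_derivative wyy y t) (at y)"
    and time: "\<And>y t. a < t \<Longrightarrow> t \<le> b \<Longrightarrow> 0 < y \<Longrightarrow> y < S t \<Longrightarrow>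
      ((\<lambda>t. w y t) has_real_derivative wt y t) (at t)"
    and heat: "\<And>y t. a < t \<Longrightarrow> t \<le> b \<Longrightarrow> 0 < y \<Longrightarrow> y < S t \<Longrightarrow> wyy y t \<le> wt y t"
    and point: "a \<le> t" "t \<le> b" "0 \<le> y" "y \<le> S t"
  shows "0 \<le> w y t"
proof (rule ccontr)
  assume neg: "\<not> 0 \<le> w y t"
  define \<Omega> where "\<Omega> = {(y, t). a \<le> t \<and> t \<le> b \<and> 0 \<le> y \<and> y \<le> S t}"
  have "compact (S ` {a..b})"
    using S_cont by (intro compact_continuous_image) auto
  then obtain Y where Y: "\<And>t. t \<in> {a..b} \<Longrightarrow> S t \<le> Y"
    by (meson bounded_imp_bdd_above compact_imp_bounded bdd_above.E imageI)
  \<comment> \<open>Small enough for v to remain negative at the given point; the summand 1 keeps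
    the denominator positive.\<close>
  define e where "e = - w y t / (2 * ((t - a) + (Y - y) + 1))"
  define v where "v y t = w y t + e * ((t - a) + (Y - y))" for y t
  have pos: "0 \<le> (t - a) + (Y - y)"
    using Y[of t] point by auto
  then have "0 < e" using neg unfolding e_def by (intro divide_pos_pos) auto
  have "e * ((t - a) + (Y - y)) \<le> - w y t / 2"
    using pos neg by (simp add: e_def field_simps)
  then have v_neg: "v y t < 0" using neg by (simp add: v_def)
  have w_le_v: "w x s \<le> v x s" if "(x, s) \<in> \<Omega>" for x s
    using that Y[of s] \<open>0 < e\<close> by (auto simp: v_def \<Omega>_def)
  have "compact \<Omega>" unfolding \<Omega>_def
    using S_cont S_pos by (intro compact_moving_region) (auto intro: less_imp_le)
  moreover have "continuous_on \<Omega> (\<lambda>(y, t). v y t)"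
    using w_cont[folded \<Omega>_def] unfolding v_def case_prod_unfold by (intro continuous_intros)
  moreover have "(y, t) \<in> \<Omega>" using point by (auto simp: \<Omega>_def)
  ultimately obtain p where p: "p \<in> \<Omega>" "\<And>r. r \<in> \<Omega> \<Longrightarrow> (\<lambda>(y, t). v y t) p \<le> (\<lambda>(y, t). v y t) r"
    using continuous_attains_inf[of \<Omega> "\<lambda>(y, t). v y t"] by blast
  obtain x s where ps: "p = (x, s)" by (cases p)
  have xs: "(x, s) \<in> \<Omega>" and min: "\<And>x' s'. (x', s') \<in> \<Omega> \<Longrightarrow> v x s \<le> v x' s'"
    using p ps by auto
  have "v x s < 0" using min[OF \<open>(y, t) \<in> \<Omega>\<close>] v_neg by simp
  then have "w x s < 0" using w_le_v[OF xs] by simp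
  have x: "0 \<le> x" "x \<le> S s" and s: "a \<le> s" "s \<le> b" using xs by (auto simp: \<Omega>_def)
  have "s \<noteq> a" using init[of x] x \<open>w x s < 0\<close> by force
  then have "a < s" using s by simp
  have "x \<noteq> S s" using lateral[OF \<open>a < s\<close> s(2)] \<open>w x s < 0\<close> by auto
  then have "x < S s" using x by simp
  show False
  proof (cases "x = 0")
    case True
    obtain D where D: "D \<le> 0" "((\<lambda>y. w y s) has_real_derivative D) (at 0 within {0..S s})"
      using flux[OF \<open>a < s\<close> s(2)] by blast
    have "((\<lambda>y. v y s) has_real_derivative D - e) (at 0 within {0..S s})"
      unfolding v_def by (rule derivative_eq_intros D refl | simp)+
    then have "0 \<le> D - e"
      using True s by (intro derivative_at_left_endpoint_min[OF _ S_pos[OF s]]) (auto intro!: min[unfolded True] simp: \<Omega>_def)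
    then show False using D \<open>0 < e\<close> by simp
  next
    case False
    then have "0 < x" using x by simp
    have "0 \<le> wyy x s"
    proof (rule second_derivative_nonneg_at_min[OF \<open>0 < x\<close> \<open>x < S s\<close>])
      show "((\<lambda>y. v y s) has_real_derivative wy y s - e) (at y)" if "0 < y" "y < S s" for y
        unfolding v_def by (rule derivative_eq_intros space[OF \<open>a < s\<close> s(2) that] refl | simp)+
      show "((\<lambda>y. wy y s - e) has_real_derivative wyy x s) (at x)"
        by (rule derivative_eq_intros space2[OF \<open>a < s\<close> s(2) \<open>0 < x\<close> \<open>x < S s\<close>] refl | simp)+
      show "v x s \<le> v y s" if "0 < y" "y < S s" for y
        using that s by (intro min) (auto simp: \<Omega>_def)
    qed
    moreover have "wt x s + e \<le> 0"
    proof -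
      \<comment> \<open>Since x < S s, the points (x, r) with r slightly below s stay in the region.
        Later times may exceed b, so the minimum is used from one side only.\<close>
      have "\<forall>\<^sub>F r in at s within {a..b}. x < S r"
        using S_cont s \<open>x < S s\<close> by (intro order_tendstoD) (auto simp: continuous_on_def)
      then obtain d where d: "0 < d" "\<And>r. r \<in> {a..b} \<Longrightarrow> r \<noteq> s \<Longrightarrow> dist r s < d \<Longrightarrow> x < S r"
        unfolding eventually_at by auto
      have deriv: "((\<lambda>t. v x t) has_real_derivative wt x s + e) (at s)"
        unfolding v_def by (rule derivative_eq_intros time[OF \<open>a < s\<close> s(2) \<open>0 < x\<close> \<open>x < S s\<close>] refl | simp)+
      have "v x s \<le> v x r" if "max a (s - d) < r" "r < s" for r
        using that s x d(2)[of r] by (intro min) (auto simp: \<Omega>_def dist_real_def)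
      moreover have "max a (s - d) < s" using \<open>a < s\<close> d by simp
      ultimately show ?thesis
        by (intro derivative_nonpos_at_left_min[OF deriv, where a = "max a (s - d)"]) auto
    qed
    ultimately show False
      using heat[OF \<open>a < s\<close> s(2) \<open>0 < x\<close> \<open>x < S s\<close>] \<open>0 < e\<close> by simp
  qed
qed

section \<open>Comparison with barriers\<close>

locale stefan_data =
  fixes q L0 Tm0 :: real
  assumes q_pos: "0 < q" and L0_pos: "0 < L0"

locale stefan = stefan_data q L0 Tm0 for q L0 Tm0 :: real +
  fixes T Ty Tyy Tt :: "real \<Rightarrow> real \<Rightarrow> real" and S :: "real \<Rightarrow> real"
  assumes S_cont: "continuous_on {0..} S"
    and S_pos: "\<And>t. 0 < t \<Longrightarrow> 0 < S t"
    and S_diff: "\<And>t. 0 < t \<Longrightarrow> S differentiable (at t)"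
    and T_cont: "continuous_on {(y, t). 0 \<le> t \<and> 0 \<le> y \<and> y \<le> S t} (\<lambda>(y, t). T y t)"
    and T_space: "\<And>y t. 0 < t \<Longrightarrow> 0 \<le> y \<Longrightarrow> y \<le> S t \<Longrightarrow>
      ((\<lambda>x. T x t) has_real_derivative Ty y t) (at y within {0..S t})"
    and T_space2: "\<And>y t. 0 < t \<Longrightarrow> 0 < y \<Longrightarrow> y < S t \<Longrightarrow>
      ((\<lambda>x. Ty x t) has_real_derivative Tyy y t) (at y)"
    and T_time: "\<And>y t. 0 < t \<Longrightarrow> 0 < y \<Longrightarrow> y < S t \<Longrightarrow>
      ((\<lambda>s. T y s) has_real_derivative Tt y t) (at t)"
    and T_heat: "\<And>y t. 0 < t \<Longrightarrow> 0 < y \<Longrightarrow> y < S t \<Longrightarrow> Tt y t = Tyy y t"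
    and T_stefan: "\<And>t. 0 < t \<Longrightarrow> - Ty (S t) t = L0 * sqrt t * deriv S t"
    and T_melt: "\<And>t. 0 < t \<Longrightarrow> T (S t) t = Tm0 * sqrt t"
    and T_flux: "\<And>t. 0 < t \<Longrightarrow> Ty 0 t = - q"
    and S_0: "S 0 = 0"

lemma stefan_solution_imp_stefan:
  assumes "0 < q" "0 < L0" "stefan_solution q L0 Tm0 T S"
  obtains Ty Tyy Tt where "stefan q L0 Tm0 T Ty Tyy Tt S"
proof -
  from assms(3) obtain Ty Tyy Tt where "stefan q L0 Tm0 T Ty Tyy Tt S"
    unfolding stefan_solution_def
  proof (elim conjE exE)
    fix Ty Tyy Tt
    assume *: "continuous_on {0..} S" "\<forall>t>0. S t > 0 \<and> S differentiable (at t)"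
      "continuous_on {(y, t). 0 \<le> t \<and> 0 \<le> y \<and> y \<le> S t} (\<lambda>(y, t). T y t)"
      "\<forall>t>0. \<forall>y\<in>{0..S t}. ((\<lambda>x. T x t) has_real_derivative Ty y t) (at y within {0..S t})"
      "\<forall>t>0. \<forall>y\<in>{0<..<S t}. ((\<lambda>x. Ty x t) has_real_derivative Tyy y t) (at y)"
      "\<forall>t>0. \<forall>y\<in>{0<..<S t}. ((\<lambda>s. T y s) has_real_derivative Tt y t) (at t)"
      "\<forall>t>0. \<forall>y\<in>{0<..<S t}. Tt y t = Tyy y t"
      "\<forall>t>0. - Ty (S t) t = L0 * sqrt t * deriv S t"
      "\<forall>t>0. T (S t) t = Tm0 * sqrt t" "\<forall>t>0. Ty 0 t = - q" "S 0 = 0"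
    have "stefan q L0 Tm0 T Ty Tyy Tt S"
    proof unfold_locales
      show "Tt y t = Tyy y t" if "0 < t" "0 < y" "y < S t" for y t
        using that by (simp add: *(7))
    qed (simp_all add: *(1-6,8-11) assms(1,2))
    then show ?thesis by (rule that)
  qed
  then show ?thesis by (rule that)
qed

context stefan
begin

lemma S_cont_Icc: "0 \<le> a \<Longrightarrow> continuous_on {a..b} S"
  by (rule continuous_on_subset[OF S_cont]) auto

lemma S_deriv: "0 < t \<Longrightarrow> (S has_real_derivative deriv S t) (at t)"
  using S_diff by (simp add: DERIV_deriv_iff_real_differentiable)

lemma T_cont_Icc:
  "0 \<le> a \<Longrightarrow> continuous_on {(y, t). a \<le> t \<and> t \<le> b \<and> 0 \<le> y \<and> y \<le> S t} (\<lambda>(y, t). T y t)"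
  by (rule continuous_on_subset[OF T_cont]) auto

lemma T_space_interior:
  "0 < t \<Longrightarrow> 0 < y \<Longrightarrow> y < S t \<Longrightarrow> ((\<lambda>x. T x t) has_real_derivative Ty y t) (at y)"
  using T_space[of t y] at_within_Icc_at[of 0 y "S t"] by simp

text \<open>The melting condition supplies the initial value: (S t, t) tends to the corner while T
  there equals Tm0 * sqrt t, so \<open>T 0 0 = 0\<close>, and continuity of T and S does the
  rest.\<close>

lemma T_small_near_corner:
  assumes "0 < e"
  obtains d where "0 < d" "\<And>t. 0 \<le> t \<Longrightarrow> t < d \<Longrightarrow> \<bar>S t\<bar> < e"
    "\<And>y t. 0 \<le> t \<Longrightarrow> t < d \<Longrightarrow> 0 \<le> y \<Longrightarrow> y \<le> S t \<Longrightarrow> \<bar>T y t\<bar> < e"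
proof -
  have pos: "0 \<le> S t" if "0 \<le> t" for t
    using S_pos[of t] that S_0 by (cases "t = 0") auto
  have "continuous_on {0..} (\<lambda>t. (\<lambda>(y, t). T y t) (S t, t))"
    by (rule continuous_on_compose2[OF T_cont]) (use S_cont pos in \<open>auto intro!: continuous_intros\<close>)
  then have "\<forall>s\<in>{0..}. ((\<lambda>t. T (S t) t) \<longlongrightarrow> T (S s) s) (at s within {0..})"
    by (simp only: continuous_on_def prod.case)
  from bspec[OF this, of 0] have "((\<lambda>t. T (S t) t) \<longlongrightarrow> T 0 0) (at 0 within {0..})"
    by (simp only: S_0 atLeast_iff order_refl)
  then have "((\<lambda>t. T (S t) t) \<longlongrightarrow> T 0 0) (at_right 0)"
    by (rule tendsto_within_subset) auto
  moreover have "((\<lambda>t. T (S t) t) \<longlongrightarrow> Tm0 * sqrt 0) (at_right 0)"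
  proof (rule Lim_transform_eventually)
    show "((\<lambda>t. Tm0 * sqrt t) \<longlongrightarrow> Tm0 * sqrt 0) (at_right 0)"
      by (rule tendsto_intros)+
  qed (auto simp: eventually_at_filter T_melt)
  ultimately have T00: "T 0 0 = 0"
    using tendsto_unique[of "at_right (0::real)" "\<lambda>t. T (S t) t" "T 0 0" "Tm0 * sqrt 0"] by simp
  obtain d1 where d1: "0 < d1" "\<And>y t. 0 \<le> t \<Longrightarrow> 0 \<le> y \<Longrightarrow> y \<le> S t \<Longrightarrow>
      dist (y, t) (0, 0) < d1 \<Longrightarrow> \<bar>T y t\<bar> < e"
  proof -
    have "(0, 0) \<in> {(y, t). 0 \<le> t \<and> 0 \<le> y \<and> y \<le> S t}" by (simp add: S_0)
    from T_cont[unfolded continuous_on_iff, THEN bspec, OF this, THEN spec, THEN mp, OF assms]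
    obtain d where d: "0 < d"
      "\<forall>p\<in>{(y, t). 0 \<le> t \<and> 0 \<le> y \<and> y \<le> S t}. dist p (0, 0) < d \<longrightarrow>
        dist ((\<lambda>(y, t). T y t) p) ((\<lambda>(y, t). T y t) (0, 0)) < e"
      by (elim exE conjE)
    show ?thesis
    proof (rule that[OF d(1)])
      fix y t assume "0 \<le> t" "0 \<le> y" "y \<le> S t" "dist (y, t) (0, 0) < d"
      with d(2)[rule_format, of "(y, t)"] T00 show "\<bar>T y t\<bar> < e"
        by (simp add: dist_real_def)
    qed
  qed
  obtain d2 where d2: "0 < d2" "\<And>t. 0 \<le> t \<Longrightarrow> t < d2 \<Longrightarrow> \<bar>S t\<bar> < min e (d1 / 2)"
  proof -
    have *: "0 < min e (d1 / 2)" "(0::real) \<in> {0..}" using assms d1(1) by auto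
    from S_cont[unfolded continuous_on_iff, THEN bspec, OF *(2), THEN spec, THEN mp, OF *(1)]
    obtain d where d: "0 < d"
      "\<forall>t\<in>{0..}. dist t 0 < d \<longrightarrow> dist (S t) (S 0) < min e (d1 / 2)"
      by (elim exE conjE)
    show ?thesis
    proof (rule that[OF d(1)])
      fix t :: real assume "0 \<le> t" "t < d"
      with d(2)[rule_format, of t] show "\<bar>S t\<bar> < min e (d1 / 2)"
        by (simp add: dist_real_def S_0)
    qed
  qed
  show ?thesis
  proof (rule that[of "min d2 (d1 / 2)"])
    fix y t assume t: "0 \<le> t" "t < min d2 (d1 / 2)" and y: "0 \<le> y" "y \<le> S t"
    have "dist (y, t) (0, 0) \<le> \<bar>y\<bar> + \<bar>t\<bar>"
      by (simp add: dist_Pair_Pair sqrt_sum_squares_le_sum_abs)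
    also have "\<bar>y\<bar> + \<bar>t\<bar> < d1"
      using t y d2(2)[of t] by linarith
    finally show "\<bar>T y t\<bar> < e" by (rule d1(2)[OF t(1) y])
  next
    show "0 < min d2 (d1 / 2)" using d1(1) d2(1) by simp
    show "\<bar>S t\<bar> < e" if "0 \<le> t" "t < min d2 (d1 / 2)" for t
      using d2(2)[of t] that by simp
  qed
qed

text \<open>
  With \<open>\<sigma> = 1\<close> the pair \<open>(V, R)\<close> is a strict supersolution, with \<open>\<sigma> = - 1\<close> a strict subsolution.
  Strictness of the Stefan condition replaces Hopf's lemma at a first contact of the two fronts.
\<close>
lemma barrier_comparison:
  fixes \<sigma> :: real and V Vy Vyy Vt :: "real \<Rightarrow> real \<Rightarrow> real"
  assumes "0 < a" "a \<le> b"
    and V_cont: "continuous_on {(y, t). 0 < t} (\<lambda>(y, t). V y t)"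
    and V_space: "\<And>y t. 0 < t \<Longrightarrow> ((\<lambda>y. V y t) has_real_derivative Vy y t) (at y)"
    and V_space2: "\<And>y t. 0 < t \<Longrightarrow> ((\<lambda>y. Vy y t) has_real_derivative Vyy y t) (at y)"
    and V_time: "\<And>y t. 0 < t \<Longrightarrow> ((\<lambda>t. V y t) has_real_derivative Vt y t) (at t)"
    and R_deriv: "\<And>t. 0 < t \<Longrightarrow> (R has_real_derivative R' t) (at t)"
    and R_init: "0 < \<sigma> * (R a - S a)"
    and V_init: "\<And>y. 0 \<le> y \<Longrightarrow> y \<le> S a \<Longrightarrow> 0 \<le> \<sigma> * (V y a - T y a)"
    and V_heat: "\<And>y t. a < t \<Longrightarrow> t \<le> b \<Longrightarrow> 0 \<le> \<sigma> * (R t - S t) \<Longrightarrow> 0 < y \<Longrightarrow> y < S t \<Longrightarrow>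
      0 \<le> \<sigma> * (Vt y t - Vyy y t)"
    and V_flux: "\<And>t. a < t \<Longrightarrow> t \<le> b \<Longrightarrow> \<sigma> * (Vy 0 t + q) \<le> 0"
    and V_lateral: "\<And>t. a < t \<Longrightarrow> t \<le> b \<Longrightarrow> 0 \<le> \<sigma> * (R t - S t) \<Longrightarrow>
      0 \<le> \<sigma> * (V (S t) t - Tm0 * sqrt t)"
    and V_melt: "\<And>t. a < t \<Longrightarrow> t \<le> b \<Longrightarrow> V (R t) t = Tm0 * sqrt t"
    and V_stefan: "\<And>t. a < t \<Longrightarrow> t \<le> b \<Longrightarrow> 0 < \<sigma> * (L0 * sqrt t * R' t + Vy (R t) t)"
    and t: "a \<le> t" "t \<le> b"
  shows "0 < \<sigma> * (R t - S t) \<and> (\<forall>y. 0 \<le> y \<longrightarrow> y \<le> S t \<longrightarrow> 0 \<le> \<sigma> * (V y t - T y t))"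
proof -
  have "\<sigma> \<noteq> 0" using R_init by auto
  \<comment> \<open>For either sign of \<sigma> the comparison takes place on the region of T, so V
    must make sense beyond its own front. It reaches up to any time c until which the fronts are
    weakly ordered.\<close>
  have ordered: "0 \<le> \<sigma> * (V y t - T y t)"
    if c: "a \<le> c" "c \<le> b" "\<And>t. a \<le> t \<Longrightarrow> t \<le> c \<Longrightarrow> 0 \<le> \<sigma> * (R t - S t)"
      and yt: "a \<le> t" "t \<le> c" "0 \<le> y" "y \<le> S t" for c y t
  proof (rule parabolic_minimum_principle[where w = "\<lambda>y t. \<sigma> * (V y t - T y t)" and S = S
        and wy = "\<lambda>y t. \<sigma> * (Vy y t - Ty y t)" and wyy = "\<lambda>y t. \<sigma> * (Vyy y t - Tyy y t)"
        and wt = "\<lambda>y t. \<sigma> * (Vt y t - Tt y t)", OF _ _ _ _ _ _ _ _ _ _ yt])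
    have "continuous_on {(y, t). a \<le> t \<and> t \<le> c \<and> 0 \<le> y \<and> y \<le> S t} (\<lambda>(y, t). V y t)"
      by (rule continuous_on_subset[OF V_cont]) (use \<open>0 < a\<close> in auto)
    with T_cont_Icc[of a c] show "continuous_on {(y, t). a \<le> t \<and> t \<le> c \<and> 0 \<le> y \<and> y \<le> S t}
        (\<lambda>(y, t). \<sigma> * (V y t - T y t))"
      using \<open>0 < a\<close> unfolding case_prod_unfold by (intro continuous_intros) auto
  next
    fix t assume t: "a < t" "t \<le> c"
    then have "0 < t" using \<open>0 < a\<close> by simp
    show "0 \<le> \<sigma> * (V (S t) t - T (S t) t)"
      using V_lateral[of t] c t \<open>0 < t\<close> by (simp add: T_melt)
    have "((\<lambda>y. \<sigma> * (V y t - T y t)) has_real_derivative \<sigma> * (Vy 0 t - Ty 0 t)) (at 0 within {0..S t})"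
      using S_pos[OF \<open>0 < t\<close>]
      by (intro DERIV_cmult DERIV_diff T_space has_field_derivative_at_within[OF V_space] \<open>0 < t\<close>) auto
    then show "\<exists>D\<le>0. ((\<lambda>y. \<sigma> * (V y t - T y t)) has_real_derivative D) (at 0 within {0..S t})"
      using V_flux[of t] c t \<open>0 < t\<close> by (auto simp: T_flux)
  next
    fix y t assume t: "a < t" "t \<le> c" and y: "0 < y" "y < S t"
    then have "0 < t" using \<open>0 < a\<close> by simp
    show "((\<lambda>y. \<sigma> * (V y t - T y t)) has_real_derivative \<sigma> * (Vy y t - Ty y t)) (at y)"
      by (intro DERIV_cmult DERIV_diff T_space_interior V_space \<open>0 < t\<close> y)
    show "((\<lambda>y. \<sigma> * (Vy y t - Ty y t)) has_real_derivative \<sigma> * (Vyy y t - Tyy y t)) (at y)"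
      by (intro DERIV_cmult DERIV_diff T_space2 V_space2 \<open>0 < t\<close> y)
    show "((\<lambda>t. \<sigma> * (V y t - T y t)) has_real_derivative \<sigma> * (Vt y t - Tt y t)) (at t)"
      by (intro DERIV_cmult DERIV_diff T_time V_time \<open>0 < t\<close> y)
    show "\<sigma> * (Vyy y t - Tyy y t) \<le> \<sigma> * (Vt y t - Tt y t)"
      using V_heat[OF _ _ _ y] c t T_heat[OF \<open>0 < t\<close> y] by (simp add: algebra_simps)
  qed (use V_init S_cont_Icc S_pos \<open>0 < a\<close> in auto)
  have gap: "0 < \<sigma> * (R t - S t)" if "a \<le> t" "t \<le> b" for t
  proof (rule ccontr)
    define g where "g t = \<sigma> * (R t - S t)" for t
    have g_deriv: "(g has_real_derivative \<sigma> * (R' t - deriv S t)) (at t)" if "0 < t" for t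
      unfolding g_def by (intro DERIV_cmult DERIV_diff R_deriv S_deriv that)
    have g_cont: "continuous_on {a..b} g"
      using \<open>0 < a\<close> by (intro continuous_at_imp_continuous_on ballI DERIV_isCont[OF g_deriv]) auto
    assume "\<not> 0 < \<sigma> * (R t - S t)"
    then have "g t \<le> 0" by (simp add: g_def)
    \<comment> \<open>The times at which the fronts touch or have crossed; the least element c is
      the first contact.\<close>
    define Q where "Q = {a..b} \<inter> g -` {..0}"
    have "closed Q"
      unfolding Q_def by (rule continuous_closed_preimage[OF g_cont]) auto
    then have "compact ({a..b} \<inter> Q)" by (rule compact_Int_closed[OF compact_Icc])
    then have "compact Q" by (simp add: Q_def Int_absorb1)
    moreover have "t \<in> Q" using that \<open>g t \<le> 0\<close> by (auto simp: Q_def)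
    ultimately obtain c where c: "c \<in> Q" "\<And>s. s \<in> Q \<Longrightarrow> c \<le> s"
      using compact_attains_inf[of Q] by auto
    have "a \<le> c" "c \<le> b" "g c \<le> 0" using c by (auto simp: Q_def)
    have before: "0 < g s" if "a \<le> s" "s < c" for s
      using c(2)[of s] that \<open>c \<le> b\<close> by (force simp: Q_def)
    have "a < c" using R_init \<open>a \<le> c\<close> \<open>g c \<le> 0\<close> by (cases "a = c") (auto simp: g_def)
    then have "0 < c" using \<open>0 < a\<close> by simp
    have "g c = 0"
    proof (rule antisym)
      have "(g \<longlongrightarrow> g c) (at_left c)"
        using continuous_at_imp_continuous_at_within[OF DERIV_isCont[OF g_deriv[OF \<open>0 < c\<close>]]]
        by (simp only: continuous_within)
      moreover have "\<forall>\<^sub>F s in at_left c. 0 \<le> g s"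
        by (rule eventually_at_leftI[OF _ \<open>a < c\<close>]) (use before in \<open>auto intro: less_imp_le\<close>)
      ultimately show "0 \<le> g c"
        by (intro tendsto_lowerbound[of g "g c" "at_left c"]) auto
    qed fact
    then have "R c = S c" using \<open>\<sigma> \<noteq> 0\<close> by (simp add: g_def)
    have nonneg: "0 \<le> g s" if "a \<le> s" "s \<le> c" for s
      using before[of s] that \<open>g c = 0\<close> by (cases "s = c") auto
    \<comment> \<open>At first contact the gap cannot be increasing. Moreover \<sigma> * (V - T)
      attains its minimum 0 at the common front, so its space derivative there is at most 0. L0 *
      sqrt c times the first inequality plus the second contradicts the strict Stefan inequality,
      since T satisfies the Stefan condition with equality.\<close>
    have "\<sigma> * (R' c - deriv S c) \<le> 0"
      by (rule derivative_nonpos_at_left_min[OF g_deriv[OF \<open>0 < c\<close>] \<open>a < c\<close>])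
         (use before \<open>g c = 0\<close> in \<open>auto intro: less_imp_le\<close>)
    then have 1: "L0 * sqrt c * (\<sigma> * (R' c - deriv S c)) \<le> 0"
      by (rule mult_nonneg_nonpos[rotated]) (use L0_pos \<open>0 < c\<close> in auto)
    have deriv: "((\<lambda>y. \<sigma> * (V y c - T y c)) has_real_derivative \<sigma> * (Vy (S c) c - Ty (S c) c))
        (at (S c) within {0..S c})"
      using S_pos[OF \<open>0 < c\<close>]
      by (intro DERIV_cmult DERIV_diff T_space has_field_derivative_at_within[OF V_space] \<open>0 < c\<close>) auto
    have "\<sigma> * (Vy (S c) c - Ty (S c) c) \<le> 0"
    proof (rule derivative_at_right_endpoint_min[OF deriv S_pos[OF \<open>0 < c\<close>]])
      fix y assume "y \<in> {0..S c}"
      then have "0 \<le> \<sigma> * (V y c - T y c)"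
        using nonneg \<open>a \<le> c\<close> \<open>c \<le> b\<close> by (intro ordered[of c]) (auto simp: g_def)
      then show "\<sigma> * (V (S c) c - T (S c) c) \<le> \<sigma> * (V y c - T y c)"
        using V_melt[OF \<open>a < c\<close> \<open>c \<le> b\<close>] T_melt[OF \<open>0 < c\<close>] \<open>R c = S c\<close> by simp
    qed
    moreover have "Ty (S c) c = - (L0 * sqrt c * deriv S c)"
      using T_stefan[OF \<open>0 < c\<close>] by simp
    ultimately have "\<sigma> * (L0 * sqrt c * R' c + Vy (R c) c) \<le> 0"
      using 1 by (simp add: algebra_simps \<open>R c = S c\<close>)
    with V_stefan[OF \<open>a < c\<close> \<open>c \<le> b\<close>] show False by simp
  qed
  have "0 \<le> \<sigma> * (V y t - T y t)" if "0 \<le> y" "y \<le> S t" for y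
    by (rule ordered[of b]) (use gap t that \<open>a \<le> b\<close> in \<open>auto intro: less_imp_le\<close>)
  with gap[OF t] show ?thesis by blast
qed

text \<open>After translation the front of the barrier starts at \<delta> > 0 and its temperature
  near the corner is at least about q * \<delta>, so continuity at the corner alone provides the
  initial ordering. The translate still solves the heat equation. At y = 0 the argument of
  \<open>serf\<close> becomes negative, which is where the sign of the amplitude enters; the
  nonnegative slope makes the profile decrease up to its front.\<close>

lemma shifted_barrier_step:
  assumes A: "0 \<le> amp q Tm0 K" and s: "0 \<le> slope q Tm0 K" "slope q Tm0 K < L0 * K"
    and "0 < \<delta>" "0 < t"
  shows "S t < 2 * K * sqrt t + \<delta>"
    and "\<And>y. 0 \<le> y \<Longrightarrow> y \<le> S t \<Longrightarrow> T y t \<le> amp q Tm0 K * heat (y - \<delta>) t - q * (y - \<delta>)"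
proof -
  have "0 < K" using s L0_pos by (meson le_less_trans zero_less_mult_pos)
  define A where "A = amp q Tm0 K"
  have "0 \<le> A" using assms(1) by (simp add: A_def)
  have decr: "A * serf x \<le> q" if "x \<le> K" for x
    using mult_left_mono[OF serf_mono[OF that] \<open>0 \<le> A\<close>] s(1) by (simp add: slope_def A_def)
  \<comment> \<open>One half of \<delta> separates the fronts; with y <= \<delta> / 2 the linear
    part of the barrier is at least q * \<delta> / 2, which exceeds T.\<close>
  define e where "e = min (\<delta> / 2) (q * \<delta> / 2)"
  have "0 < e" using \<open>0 < \<delta>\<close> q_pos by (simp add: e_def)
  obtain d where d: "0 < d" "\<And>t. 0 \<le> t \<Longrightarrow> t < d \<Longrightarrow> \<bar>S t\<bar> < e"
    "\<And>y t. 0 \<le> t \<Longrightarrow> t < d \<Longrightarrow> 0 \<le> y \<Longrightarrow> y \<le> S t \<Longrightarrow> \<bar>T y t\<bar> < e"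
    using T_small_near_corner[OF \<open>0 < e\<close>] by blast
  define a where "a = min (d / 2) t"
  have a: "0 < a" "a < d" "a \<le> t" using d(1) \<open>0 < t\<close> by (auto simp: a_def)
  let ?V = "\<lambda>y t. A * heat (y - \<delta>) t - q * (y - \<delta>)"
  let ?R = "\<lambda>t. 2 * K * sqrt t + \<delta>"
  have melt: "?V (?R t) t = Tm0 * sqrt t" if "0 < t" for t
    using profile_at_front[OF that, of q Tm0 K] by (simp add: A_def)
  have "0 < 1 * (?R t - S t) \<and> (\<forall>y. 0 \<le> y \<longrightarrow> y \<le> S t \<longrightarrow> 0 \<le> 1 * (?V y t - T y t))"
  proof (rule barrier_comparison[where R = ?R and V = ?V and \<sigma> = 1 and a = a and b = t
        and Vy = "\<lambda>y t. A * serf ((y - \<delta>) / (2 * sqrt t)) - q"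
        and Vyy = "\<lambda>y t. A * (exp (- ((y - \<delta>) / (2 * sqrt t))\<^sup>2) / sqrt t)"
        and Vt = "\<lambda>y t. A * (exp (- ((y - \<delta>) / (2 * sqrt t))\<^sup>2) / sqrt t)"
        and R' = "\<lambda>t. K / sqrt t"])
    show "continuous_on {(y, t). 0 < t} (\<lambda>(y, t). ?V y t)"
      unfolding case_prod_unfold by (intro continuous_intros) auto
    show "((\<lambda>y. ?V y t) has_real_derivative A * serf ((y - \<delta>) / (2 * sqrt t)) - q) (at y)"
      if "0 < t" for y t
      using that by (auto intro!: derivative_eq_intros)
    show "((\<lambda>y. A * serf ((y - \<delta>) / (2 * sqrt t)) - q) has_real_derivative
        A * (exp (- ((y - \<delta>) / (2 * sqrt t))\<^sup>2) / sqrt t)) (at y)" if "0 < t" for y t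
      using DERIV_shift[THEN iffD1, OF heat_deriv_space2[OF that]]
      using that by (auto intro!: derivative_eq_intros simp: real_div_sqrt field_simps)
    show "((\<lambda>t. ?V y t) has_real_derivative A * (exp (- ((y - \<delta>) / (2 * sqrt t))\<^sup>2) / sqrt t)) (at t)"
      if "0 < t" for y t
      using that by (auto intro!: derivative_eq_intros)
    show "(?R has_real_derivative K / sqrt t) (at t)" if "0 < t" for t
      using that by (auto intro!: derivative_eq_intros simp: field_simps)
    have "0 < 2 * K * sqrt a" using \<open>0 < K\<close> a by simp
    moreover have "\<bar>S a\<bar> < \<delta> / 2" using d(2)[of a] a by (simp add: e_def)
    ultimately show "0 < 1 * (?R a - S a)"
      using abs_ge_self[of "S a"] \<open>0 < \<delta>\<close> unfolding mult_1 by linarith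
    show "0 \<le> 1 * (?V y a - T y a)" if "0 \<le> y" "y \<le> S a" for y
    proof -
      have "y \<le> \<delta> / 2" "T y a \<le> q * \<delta> / 2"
        using d(2)[of a] d(3)[of a y] that a by (auto simp: e_def)
      moreover have "0 \<le> A * heat (y - \<delta>) a" using \<open>0 \<le> A\<close> a by (simp add: heat_nonneg)
      moreover have "q * (y - \<delta>) \<le> q * (- \<delta> / 2)"
        using \<open>y \<le> \<delta> / 2\<close> q_pos by (intro mult_left_mono) auto
      ultimately show ?thesis by simp
    qed
    show "1 * (A * serf ((0 - \<delta>) / (2 * sqrt t)) - q + q) \<le> 0" if "a < t" for t
    proof -
      have "serf ((0 - \<delta>) / (2 * sqrt t)) \<le> serf 0"
        using that a \<open>0 < \<delta>\<close> by (intro serf_mono) (simp add: field_simps)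
      then show ?thesis using \<open>0 \<le> A\<close> by (simp add: mult_nonneg_nonpos)
    qed
    show "0 \<le> 1 * (?V (S t) t - Tm0 * sqrt t)" if "a < t" "0 \<le> 1 * (?R t - S t)" for t
    proof -
      have "0 < t" using that a by simp
      have "(S t - \<delta>) / (2 * sqrt t) \<le> K"
        using that(2) \<open>0 < t\<close> by (simp add: field_simps)
      then have "A * heat_profile K - q * K \<le>
          A * heat_profile ((S t - \<delta>) / (2 * sqrt t)) - q * ((S t - \<delta>) / (2 * sqrt t))"
        using decr by (intro profile_antimono) auto
      from mult_left_mono[OF this, of "2 * sqrt t"] profile_scaling[OF \<open>0 < t\<close>, of A "S t - \<delta>" q] \<open>0 < t\<close>
      show ?thesis by (simp add: A_def amp_times_heat_profile)
    qed
    show "0 < 1 * (L0 * sqrt t * (K / sqrt t) + (A * serf ((?R t - \<delta>) / (2 * sqrt t)) - q))"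
      if "a < t" for t
      using that a s(2) by (simp add: slope_def A_def)
  qed (use a melt in auto)
  then show "S t < 2 * K * sqrt t + \<delta>"
    and "\<And>y. 0 \<le> y \<Longrightarrow> y \<le> S t \<Longrightarrow> T y t \<le> amp q Tm0 K * heat (y - \<delta>) t - q * (y - \<delta>)"
    by (auto simp: A_def)
qed

text \<open>The limit \<delta> -> 0 improves mere continuity at the corner to bounds of order sqrt
  t, the scale on which drifting barriers can start.\<close>

lemma shifted_barrier:
  assumes "0 \<le> amp q Tm0 K" "0 \<le> slope q Tm0 K" "slope q Tm0 K < L0 * K" "0 < t"
  shows "S t \<le> 2 * K * sqrt t"
    and "\<And>y. 0 \<le> y \<Longrightarrow> y \<le> S t \<Longrightarrow> T y t \<le> amp q Tm0 K * heat y t - q * y"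
proof -
  show "S t \<le> 2 * K * sqrt t"
    using shifted_barrier_step(1)[OF assms(1-3) _ assms(4)] by (meson field_le_epsilon less_imp_le)
  fix y assume y: "0 \<le> y" "y \<le> S t"
  have "continuous_on UNIV (\<lambda>\<delta>. amp q Tm0 K * heat (y - \<delta>) t - q * (y - \<delta>))"
    using assms(4) by (intro continuous_intros)
  then have "((\<lambda>\<delta>. amp q Tm0 K * heat (y - \<delta>) t - q * (y - \<delta>)) \<longlongrightarrow>
      amp q Tm0 K * heat (y - 0) t - q * (y - 0)) (at_right 0)"
    by (meson UNIV_I continuous_on_def tendsto_within_subset top_greatest)
  moreover have "\<forall>\<^sub>F \<delta> in at_right 0. T y t \<le> amp q Tm0 K * heat (y - \<delta>) t - q * (y - \<delta>)"
    using shifted_barrier_step(2)[OF assms(1-3) _ assms(4) y] by (auto simp: eventually_at_filter)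
  ultimately have "T y t \<le> amp q Tm0 K * heat (y - 0) t - q * (y - 0)"
    by (intro tendsto_lowerbound) auto
  then show "T y t \<le> amp q Tm0 K * heat y t - q * y" by simp
qed

end

section \<open>The equation for the front coefficient\<close>

text \<open>The equation for \<open>\<gamma>\<close> solved for \<open>Tm0 / 2\<close>, which makes it monotone in \<open>\<gamma>\<close>.\<close>
definition front :: "real \<Rightarrow> real \<Rightarrow> real \<Rightarrow> real" where
  "front q L0 g = (q - L0 * g) * exp (- g\<^sup>2) / serf g - L0 * g\<^sup>2"

text \<open>The part with q decreases because exp(-g^2) decreases and \<open>serf\<close> increases.
  In the part with L0, called r below, the growth of g^2 outweighs the variation of the
  quotient.\<close>

lemma front_strict_antimono:
  assumes "0 < q" "0 < L0" "0 < x" "x < y"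
  shows "front q L0 y < front q L0 x"
proof -
  have pos: "0 < serf x" "0 < serf y" using assms serf_pos by auto
  have "exp (- y\<^sup>2) / serf y < exp (- x\<^sup>2) / serf x"
    using assms pos serf_strict_mono[of x y]
    by (intro frac_less) (auto simp: power_strict_mono intro: power_mono)
  then have 1: "q * (exp (- y\<^sup>2) / serf y) < q * (exp (- x\<^sup>2) / serf x)"
    using \<open>0 < q\<close> by (rule mult_strict_left_mono)
  define r where "r g = g * exp (- g\<^sup>2) / serf g + g\<^sup>2" for g
  have "r x < r y"
  proof (rule DERIV_pos_imp_increasing[OF \<open>x < y\<close>])
    fix g assume "x \<le> g" "g \<le> y"
    then have g: "0 < g" "0 < serf g" using assms serf_pos by auto
    define e where "e = exp (- g\<^sup>2)"
    have e: "0 < e" "2 * g * e \<le> serf g" using serf_ge[of g] g by (auto simp: e_def)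
    have "(r has_real_derivative
        ((e - 2 * g\<^sup>2 * e) * serf g - g * e * (2 * e)) / (serf g)\<^sup>2 + 2 * g) (at g)"
      unfolding r_def e_def using g
      by (auto intro!: derivative_eq_intros simp: field_simps power2_eq_square)
    \<comment> \<open>Regrouped so that \<open>2 * g * e \<le> serf g\<close> makes the first
      summand nonnegative and the second positive.\<close>
    also have "((e - 2 * g\<^sup>2 * e) * serf g - g * e * (2 * e)) / (serf g)\<^sup>2 + 2 * g =
        (e * (serf g - 2 * g * e) + 2 * g * serf g * (serf g - g * e)) / (serf g)\<^sup>2"
      using g by (simp add: field_simps power2_eq_square)
    finally have "(r has_real_derivative
        (e * (serf g - 2 * g * e) + 2 * g * serf g * (serf g - g * e)) / (serf g)\<^sup>2) (at g)" .
    moreover have "0 < (e * (serf g - 2 * g * e) + 2 * g * serf g * (serf g - g * e)) / (serf g)\<^sup>2"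
    proof (intro divide_pos_pos add_nonneg_pos mult_nonneg_nonneg mult_pos_pos)
      have "0 < g * e" using g e by simp
      then show "0 < serf g - g * e" using e by linarith
    qed (use g e in auto)
    ultimately show "\<exists>D. (r has_real_derivative D) (at g) \<and> 0 < D" by blast
  qed
  then have "L0 * r x < L0 * r y" using \<open>0 < L0\<close> by simp
  moreover have "front q L0 g = q * (exp (- g\<^sup>2) / serf g) - L0 * r g" for g
    by (simp add: front_def r_def algebra_simps diff_divide_distrib)
  ultimately show ?thesis using 1 by simp
qed

text \<open>Both denominators are positive, and after cross-multiplication the terms q * g * serf g
  cancel.\<close>

lemma gamma_eq_iff_front:
  assumes "0 < g"
  shows "gamma_eq q L0 Tm0 g \<longleftrightarrow> front q L0 g = Tm0 / 2"
proof -
  have pos: "0 < serf g" "serf g \<noteq> 0" using serf_pos[OF assms] by auto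
  have "gamma_eq q L0 Tm0 g \<longleftrightarrow> (Tm0 / 2 + q * g) / heat_profile g = (q - L0 * g) / serf g"
    by (simp add: gamma_eq_def heat_profile_def serf_def mult_ac)
  also have "\<dots> \<longleftrightarrow> (Tm0 / 2 + q * g) * serf g = (q - L0 * g) * heat_profile g"
    using pos by (simp add: frac_eq_eq)
  also have "\<dots> \<longleftrightarrow> (q - L0 * g) * exp (- g\<^sup>2) = (Tm0 / 2 + L0 * g\<^sup>2) * serf g"
    by (auto simp: heat_profile_def algebra_simps power2_eq_square)
  also have "\<dots> \<longleftrightarrow> front q L0 g = Tm0 / 2"
    using pos by (auto simp: front_def field_simps)
  finally show ?thesis .
qed

lemma ex1_gamma:
  assumes "0 < q" "0 < L0"
  shows "\<exists>!\<gamma>. 0 < \<gamma> \<and> gamma_eq q L0 Tm0 \<gamma>"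
proof (rule ex_ex1I)
  \<comment> \<open>The equation cleared of its denominator, hence continuous at 0, where
    \<open>front\<close> is singular in the limit.\<close>
  define G where "G x = serf x * (Tm0 / 2 + L0 * x\<^sup>2) - (q - L0 * x) * exp (- x\<^sup>2)" for x
  \<comment> \<open>Large enough for L0 * b to exceed q and |Tm0|; with b >= 1 then L0 * b^2 also
    exceeds |Tm0|, so both parts of G b are nonnegative.\<close>
  define b where "b = q / L0 + \<bar>Tm0\<bar> / L0 + 1"
  have b: "1 \<le> b" "q \<le> L0 * b" "\<bar>Tm0\<bar> \<le> L0 * b"
    using assms by (auto simp: b_def field_simps)
  have "L0 * b * 1 \<le> L0 * b * b" using b assms by (intro mult_left_mono) auto
  then have "0 \<le> Tm0 / 2 + L0 * b\<^sup>2" using b by (simp add: power2_eq_square)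
  then have "0 \<le> serf b * (Tm0 / 2 + L0 * b\<^sup>2)"
    using b serf_pos[of b] by (intro mult_nonneg_nonneg) auto
  moreover have "(q - L0 * b) * exp (- b\<^sup>2) \<le> 0"
    using b by (intro mult_nonpos_nonneg) auto
  ultimately have "0 \<le> G b" by (simp add: G_def)
  moreover have "G 0 \<le> 0" using assms by (simp add: G_def)
  moreover have "continuous_on {0..b} G" unfolding G_def by (intro continuous_intros)
  ultimately obtain x where x: "0 \<le> x" "G x = 0"
    using IVT'[of G 0 0 b] b by force
  then have "x \<noteq> 0" using assms by (auto simp: G_def)
  with x have "0 < x" "front q L0 x = Tm0 / 2"
    using serf_pos[of x] by (auto simp: G_def front_def field_simps)
  then show "\<exists>\<gamma>. 0 < \<gamma> \<and> gamma_eq q L0 Tm0 \<gamma>"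
    using gamma_eq_iff_front by blast
next
  fix x y assume "0 < x \<and> gamma_eq q L0 Tm0 x" "0 < y \<and> gamma_eq q L0 Tm0 y"
  then show "x = y"
    using front_strict_antimono[OF assms, of x y] front_strict_antimono[OF assms, of y x]
    by (cases x y rule: linorder_cases) (auto simp: gamma_eq_iff_front)
qed

text \<open>The defect in the Stefan condition is a positive multiple of Tm0 / 2 - front, so
  monotonicity of \<open>front\<close> decides its sign on either side of the root.\<close>

lemma slope_front:
  assumes "0 < g"
  shows "L0 * g - slope q Tm0 g = serf g / heat_profile g * (Tm0 / 2 - front q L0 g)"
proof -
  have "serf g \<noteq> 0" using serf_pos[OF assms] by simp
  then have "serf g * (Tm0 / 2 - front q L0 g) =
      L0 * g * heat_profile g - (q * exp (- g\<^sup>2) - Tm0 / 2 * serf g)"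
    by (simp add: front_def heat_profile_def field_simps power2_eq_square)
  then show ?thesis by (simp add: slope_eq field_simps)
qed

locale gamma_root = stefan_data q L0 Tm0 for q L0 Tm0 :: real +
  fixes \<gamma> :: real
  assumes gamma_pos: "0 < \<gamma>" and gamma_eq: "gamma_eq q L0 Tm0 \<gamma>"
begin

lemma front_gamma: "front q L0 \<gamma> = Tm0 / 2"
  using gamma_eq gamma_pos gamma_eq_iff_front by blast

lemma slope_gamma: "slope q Tm0 \<gamma> = L0 * \<gamma>"
  using slope_front[OF gamma_pos, of L0 q Tm0] front_gamma by simp

lemma slope_less: "\<gamma> < g \<Longrightarrow> slope q Tm0 g < L0 * g"
  using slope_front[of g L0 q Tm0] front_strict_antimono[OF q_pos L0_pos gamma_pos, of g]
    front_gamma gamma_pos serf_pos[of g] heat_profile_pos[of g]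
  by (smt (verit) divide_pos_pos mult_pos_pos)

lemma slope_greater: "0 \<le> g \<Longrightarrow> g < \<gamma> \<Longrightarrow> L0 * g < slope q Tm0 g"
proof (cases "g = 0")
  case False
  assume "0 \<le> g" "g < \<gamma>"
  then have "front q L0 \<gamma> < front q L0 g" "0 < serf g / heat_profile g" "0 < g"
    using False front_strict_antimono[OF q_pos L0_pos, of g \<gamma>] serf_pos[of g] by auto
  then show ?thesis
    using slope_front[of g L0 q Tm0] front_gamma
    by (smt (verit) mult_pos_neg)
qed (use q_pos in \<open>simp add: slope_def\<close>)

lemma amp_gamma: "amp q Tm0 \<gamma> = (q - L0 * \<gamma>) / serf \<gamma>"
  using slope_gamma serf_pos[OF gamma_pos] by (simp add: slope_def field_simps)

text \<open>Here the equation for \<gamma> enters, through \<open>amp_gamma\<close>. At t = 0 the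
  quotient y / (2 * sqrt t) is 0 by convention and both sides equal - q * y.\<close>

lemma explicit_T_eq:
  assumes "0 \<le> t"
  shows "explicit_T q L0 \<gamma> y t = amp q Tm0 \<gamma> * heat y t - q * y"
proof -
  have "(y / (2 * sqrt t))\<^sup>2 = y\<^sup>2 / (4 * t)"
    using assms by (simp add: power_divide power_mult_distrib)
  moreover have "2 * sqrt t * (y / (2 * sqrt t) * serf (y / (2 * sqrt t))) = y * serf (y / (2 * sqrt t))"
    by (cases "t = 0") auto
  ultimately have "heat y t = 2 * sqrt t * exp (- (y\<^sup>2 / (4 * t))) + y * serf (y / (2 * sqrt t))"
    unfolding heat_def heat_profile_def distrib_left by presburger
  then show ?thesis
    by (simp add: explicit_T_def amp_gamma serf_def mult_ac)
qed

end

section \<open>Quasi-stationary barriers\<close>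

lemma abs_slope_le:
  assumes "0 < q" shows "\<bar>slope q \<tau> g\<bar> \<le> q + \<bar>\<tau>\<bar>"
proof -
  have "exp (- g\<^sup>2) \<le> 1" by simp
  then have 1: "q * exp (- g\<^sup>2) \<le> q * heat_profile g"
    using heat_profile_ge_1[of g] assms by (intro mult_left_mono) linarith+
  have 2: "\<bar>\<tau> / 2 * serf g\<bar> \<le> \<bar>\<tau>\<bar> * heat_profile g"
    using mult_left_mono[OF abs_serf_le_heat_profile[of g], of "\<bar>\<tau>\<bar> / 2"] by (simp add: abs_mult)
  have "\<bar>q * exp (- g\<^sup>2) - \<tau> / 2 * serf g\<bar> \<le> q * exp (- g\<^sup>2) + \<bar>\<tau> / 2 * serf g\<bar>"
    using assms abs_triangle_ineq4[of "q * exp (- g\<^sup>2)" "\<tau> / 2 * serf g"] by (simp add: abs_mult)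
  also have "\<dots> \<le> (q + \<bar>\<tau>\<bar>) * heat_profile g" using 1 2 by (simp add: algebra_simps)
  finally show ?thesis by (simp add: slope_eq field_simps)
qed

lemma slope_shift:
  "slope q (\<tau> - \<mu>) g = slope q \<tau> g + \<mu> / 2 * (serf g / heat_profile g)"
  by (simp add: slope_eq field_simps)

lemma continuous_on_slope: "continuous_on A (slope q \<tau>)"
  unfolding slope_def by (intro continuous_intros)

text \<open>The order of choices matters: compactness of the range of g gives a uniform slack d,
  then m is small against d, and only then the drift speed \<epsilon> is small against d and against
  m, because m has to absorb the error caused by the drift.\<close>

lemma quasi_stationary_parameters:
  assumes "0 < q" "0 < L0" and \<sigma>: "\<sigma> = 1 \<or> \<sigma> = (- 1 :: real)" and "0 < m0"
    and slack: "\<And>g. lo \<le> g \<Longrightarrow> g \<le> hi \<Longrightarrow> 0 < \<sigma> * (L0 * g - slope q Tm0 g)"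
  obtains m \<epsilon> where "0 < m" "m < m0" "0 < \<epsilon>"
    "\<And>g. lo \<le> g \<Longrightarrow> g \<le> hi \<Longrightarrow> 2 * \<epsilon> * L0 < \<sigma> * (L0 * g - slope q (Tm0 - \<sigma> * m) g)"
    "\<And>g. lo \<le> g \<Longrightarrow> g \<le> hi \<Longrightarrow> 4 * \<epsilon> * \<bar>slope q (Tm0 - \<sigma> * m) g\<bar> * heat_profile \<kappa> \<le> m"
proof -
  obtain d where d: "0 < d" "\<And>g. lo \<le> g \<Longrightarrow> g \<le> hi \<Longrightarrow> d \<le> \<sigma> * (L0 * g - slope q Tm0 g)"
  proof (cases "lo \<le> hi")
    case True
    have "continuous_on {lo..hi} (\<lambda>g. \<sigma> * (L0 * g - slope q Tm0 g))"
      by (intro continuous_intros continuous_on_slope)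
    moreover have "{lo..hi} \<noteq> {}" using True by simp
    ultimately obtain g where g: "g \<in> {lo..hi}"
      "\<forall>x\<in>{lo..hi}. \<sigma> * (L0 * g - slope q Tm0 g) \<le> \<sigma> * (L0 * x - slope q Tm0 x)"
      using continuous_attains_inf[OF compact_Icc] by blast
    show ?thesis
      by (rule that[OF slack]) (use g in auto)
  qed (use that[of 1] in auto)
  \<comment> \<open>Changing \<tau> by \<sigma> * m costs at most m <= d / 4 of the slack, and the
    drift needs 2 * \<epsilon> * L0 <= d / 2, so a quarter of d is left.\<close>
  define m where "m = min (d / 4) (m0 / 2)"
  define B where "B = q + \<bar>Tm0\<bar> + m0"
  define \<epsilon> where "\<epsilon> = min (d / (4 * L0)) (m / (4 * B * heat_profile \<kappa>))"
  have m: "0 < m" "m < m0" "m \<le> d / 4" using d \<open>0 < m0\<close> by (auto simp: m_def)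
  have B: "0 < B" using assms by (simp add: B_def add_pos_nonneg)
  have \<epsilon>: "0 < \<epsilon>" "\<epsilon> \<le> d / (4 * L0)" "\<epsilon> \<le> m / (4 * B * heat_profile \<kappa>)"
    using d(1) m(1) B \<open>0 < L0\<close> by (simp_all add: \<epsilon>_def min.coboundedI1 min.coboundedI2)
  show ?thesis
  proof (rule that[OF m(1,2) \<epsilon>(1)])
    fix g assume g: "lo \<le> g" "g \<le> hi"
    have "serf g / heat_profile g \<le> 2"
      using abs_serf_le_heat_profile[of g] by (simp add: pos_divide_le_eq abs_le_iff)
    then have "m / 2 * (serf g / heat_profile g) \<le> m / 2 * 2"
      using m by (intro mult_left_mono) auto
    moreover have "\<sigma> * (L0 * g - slope q (Tm0 - \<sigma> * m) g) =
        \<sigma> * (L0 * g - slope q Tm0 g) - m / 2 * (serf g / heat_profile g)"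
      using \<sigma> by (auto simp: slope_shift algebra_simps)
    moreover have "2 * \<epsilon> * L0 \<le> d / 2"
      using \<epsilon>(2) assms by (simp add: field_simps)
    ultimately show "2 * \<epsilon> * L0 < \<sigma> * (L0 * g - slope q (Tm0 - \<sigma> * m) g)"
      using d(2)[OF g] d(1) m by linarith
    have "\<bar>Tm0 - \<sigma> * m\<bar> \<le> \<bar>Tm0\<bar> + m0" using \<sigma> m by auto
    then have "\<bar>slope q (Tm0 - \<sigma> * m) g\<bar> \<le> B"
      using abs_slope_le[OF \<open>0 < q\<close>, of "Tm0 - \<sigma> * m" g] by (simp add: B_def)
    then have "4 * \<epsilon> * \<bar>slope q (Tm0 - \<sigma> * m) g\<bar> * heat_profile \<kappa> \<le> 4 * \<epsilon> * B * heat_profile \<kappa>"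
      using \<epsilon> by (intro mult_right_mono mult_left_mono) (auto intro: less_imp_le)
    also have "\<dots> \<le> m"
      using \<epsilon>(3) B by (simp add: pos_le_divide_eq mult_ac)
    finally show "4 * \<epsilon> * \<bar>slope q (Tm0 - \<sigma> * m) g\<bar> * heat_profile \<kappa> \<le> m" .
  qed
qed

context stefan
begin

text \<open>
  The front of the barrier is \<open>2 g(t) \<surd>t\<close> with \<open>g(t) = g0 - \<sigma> \<epsilon> ln (t / a)\<close>, which reaches \<open>g1\<close>
  at time \<open>b\<close>.
\<close>
lemma quasi_stationary_barrier:
  fixes \<sigma> m \<epsilon> a g0 g1 \<kappa> :: real
  defines "\<tau> \<equiv> Tm0 - \<sigma> * m" and "b \<equiv> a * exp (\<sigma> * (g0 - g1) / \<epsilon>)"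
  assumes \<sigma>: "\<sigma> = 1 \<or> \<sigma> = - 1" and m: "0 < m" and \<epsilon>: "0 < \<epsilon>" and a: "0 < a"
    and range: "0 \<le> \<sigma> * (g0 - g1)"
    and slack: "\<And>g. 0 \<le> \<sigma> * (g0 - g) \<Longrightarrow> 0 \<le> \<sigma> * (g - g1) \<Longrightarrow>
      2 * \<epsilon> * L0 < \<sigma> * (L0 * g - slope q \<tau> g)"
    and small: "\<And>g. 0 \<le> \<sigma> * (g0 - g) \<Longrightarrow> 0 \<le> \<sigma> * (g - g1) \<Longrightarrow>
      4 * \<epsilon> * \<bar>slope q \<tau> g\<bar> * heat_profile \<kappa> \<le> m"
    and bound: "\<And>t. 0 < t \<Longrightarrow> S t \<le> 2 * \<kappa> * sqrt t"
    and decr: "\<And>g x. 0 \<le> \<sigma> * (g0 - g) \<Longrightarrow> 0 \<le> \<sigma> * (g - g1) \<Longrightarrow> 0 \<le> x \<Longrightarrow> x \<le> \<kappa> \<Longrightarrow>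
      0 \<le> \<sigma> * (g - x) \<Longrightarrow>
      0 \<le> \<sigma> * (amp q \<tau> g * heat_profile x - q * x - (amp q \<tau> g * heat_profile g - q * g))"
    and S_init: "0 < \<sigma> * (2 * g0 * sqrt a - S a)"
    and T_init: "\<And>y. 0 \<le> y \<Longrightarrow> y \<le> S a \<Longrightarrow>
      0 \<le> \<sigma> * (amp q \<tau> g0 * heat y a - q * y + \<sigma> * m * sqrt a - T y a)"
  shows "0 < \<sigma> * (2 * g1 * sqrt b - S b)"
proof -
  have \<sigma>\<sigma>: "\<sigma> * \<sigma> = 1" "\<And>x. \<sigma> * (\<sigma> * x) = x" using \<sigma> by auto
  define g where "g t = g0 - \<sigma> * \<epsilon> * ln (t / a)" for t
  have ab: "a \<le> b" unfolding b_def using a range \<epsilon> by simp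
  have g_range: "0 \<le> \<sigma> * (g0 - g t)" "0 \<le> \<sigma> * (g t - g1)" if "a \<le> t" "t \<le> b" for t
  proof -
    have "\<sigma> * (g0 - g t) = \<sigma> * \<sigma> * (\<epsilon> * ln (t / a))"
      "\<sigma> * (g t - g1) = \<sigma> * (g0 - g1) - \<sigma> * \<sigma> * (\<epsilon> * ln (t / a))"
      by (simp_all add: g_def right_diff_distrib mult_ac)
    then have eq: "\<sigma> * (g0 - g t) = \<epsilon> * ln (t / a)"
      "\<sigma> * (g t - g1) = \<sigma> * (g0 - g1) - \<epsilon> * ln (t / a)"
      unfolding \<sigma>\<sigma>(1) by simp_all
    have "ln (t / a) \<le> ln (exp (\<sigma> * (g0 - g1) / \<epsilon>))"
      using that a by (subst ln_le_cancel_iff) (auto simp: b_def field_simps)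
    then have "\<epsilon> * ln (t / a) \<le> \<epsilon> * (\<sigma> * (g0 - g1) / \<epsilon>)"
      using \<epsilon> by (intro mult_left_mono) auto
    then show "0 \<le> \<sigma> * (g t - g1)" using \<epsilon> unfolding eq by simp
    show "0 \<le> \<sigma> * (g0 - g t)" unfolding eq using that a \<epsilon> by simp
  qed
  have g_deriv: "(g has_real_derivative - \<sigma> * \<epsilon> / t) (at t)" if "0 < t" for t
    unfolding g_def using that a by (auto intro!: derivative_eq_intros)
  have g_a: "g a = g0" using a by (simp add: g_def)
  have g_b: "g b = g1" using a \<epsilon> by (simp add: g_def b_def \<sigma>\<sigma>)
  \<comment> \<open>The time derivative of \<sigma> * m * sqrt t has the same order 1 / sqrt t as
    the error of the drift. Using \<tau> = Tm0 - \<sigma> * m in the profile compensates the added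
    term at the front.\<close>
  let ?V = "\<lambda>y t. amp q \<tau> (g t) * heat y t - q * y + \<sigma> * m * sqrt t"
  let ?K = "\<lambda>y t. exp (- (y / (2 * sqrt t))\<^sup>2) / sqrt t"
  have melt: "2 * sqrt t * (amp q \<tau> (g t) * heat_profile (g t) - q * g t) + \<sigma> * m * sqrt t = Tm0 * sqrt t" for t
  proof -
    have "2 * sqrt t * (amp q \<tau> (g t) * heat_profile (g t) - q * g t) = \<tau> * sqrt t"
      unfolding amp_times_heat_profile by simp
    then show ?thesis by (simp add: \<tau>_def algebra_simps)
  qed
  have "0 < \<sigma> * (2 * g b * sqrt b - S b)"
  proof (rule conjunct1[OF barrier_comparison[where R = "\<lambda>t. 2 * g t * sqrt t" and V = ?V and \<sigma> = \<sigma>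
        and a = a and b = b and Vy = "\<lambda>y t. amp q \<tau> (g t) * serf (y / (2 * sqrt t)) - q"
        and Vyy = "\<lambda>y t. amp q \<tau> (g t) * ?K y t"
        and Vt = "\<lambda>y t. slope q \<tau> (g t) / heat_profile (g t) * (- \<sigma> * \<epsilon> / t) * heat y t +
          amp q \<tau> (g t) * ?K y t + \<sigma> * m / (2 * sqrt t)"
        and R' = "\<lambda>t. (g t - 2 * \<sigma> * \<epsilon>) / sqrt t"]])
    have "continuous_on {0<..} g"
      by (intro continuous_at_imp_continuous_on ballI DERIV_isCont[OF g_deriv]) simp
    then have "continuous_on {p :: real \<times> real. 0 < snd p} (\<lambda>p. g (snd p))"
      by (rule continuous_on_compose2[OF _ continuous_on_snd[OF continuous_on_id]]) auto
    then show "continuous_on {(y, t). 0 < t} (\<lambda>(y, t). ?V y t)"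
      unfolding case_prod_unfold
      by (intro continuous_on_add continuous_on_diff continuous_on_mult continuous_on_amp
          continuous_on_heat continuous_on_const continuous_on_fst continuous_on_snd
          continuous_on_id continuous_on_real_sqrt) auto
    show "((\<lambda>y. ?V y t) has_real_derivative amp q \<tau> (g t) * serf (y / (2 * sqrt t)) - q) (at y)"
      if "0 < t" for y t
      by (rule DERIV_cong[OF DERIV_add[OF DERIV_diff[OF DERIV_cmult[OF heat_deriv_space[OF that]]
            DERIV_cmult[OF DERIV_ident]] DERIV_const]]) simp
    show "((\<lambda>y. amp q \<tau> (g t) * serf (y / (2 * sqrt t)) - q) has_real_derivative
        amp q \<tau> (g t) * ?K y t) (at y)" if "0 < t" for y t
      by (rule DERIV_cong[OF DERIV_diff[OF DERIV_cmult[OF heat_deriv_space2[OF that]] DERIV_const]]) simp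
    show "((\<lambda>t. ?V y t) has_real_derivative slope q \<tau> (g t) / heat_profile (g t) * (- \<sigma> * \<epsilon> / t) * heat y t +
          amp q \<tau> (g t) * ?K y t + \<sigma> * m / (2 * sqrt t)) (at t)" if "0 < t" for y t
      by (rule DERIV_cong[OF DERIV_add[OF DERIV_diff[OF DERIV_mult[OF
              DERIV_chain2[OF amp_has_real_derivative g_deriv[OF that]] heat_deriv_time[OF that]]
            DERIV_const] DERIV_cmult[OF DERIV_real_sqrt[OF that]]]])
         (simp add: inverse_eq_divide mult_ac)
    \<comment> \<open>The drift changes the speed of the front by - 2 * \<sigma> * \<epsilon> / sqrt
      t; this is the margin 2 * \<epsilon> * L0 demanded in \<open>slack\<close>.\<close>
    show "((\<lambda>t. 2 * g t * sqrt t) has_real_derivative (g t - 2 * \<sigma> * \<epsilon>) / sqrt t) (at t)"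
      if "0 < t" for t
    proof -
      have "2 * (- \<sigma> * \<epsilon> / t) * sqrt t + inverse (sqrt t) / 2 * (2 * g t) =
          (g t - 2 * \<sigma> * \<epsilon>) / sqrt t"
        using that real_sqrt_mult_self[of t] by (simp add: field_simps)
      with DERIV_mult[OF DERIV_cmult[OF g_deriv[OF that]] DERIV_real_sqrt[OF that], of 2]
      show ?thesis by (rule DERIV_cong)
    qed
    \<comment> \<open>The terms with ?K cancel. The bound on S keeps the similarity variable below
      \<kappa>, so the drift error heat y t / t = 2 * heat_profile \<eta> / sqrt t is dominated by
      the term with m through \<open>small\<close>.\<close>
    show "0 \<le> \<sigma> * (slope q \<tau> (g t) / heat_profile (g t) * (- \<sigma> * \<epsilon> / t) * heat y t +
        amp q \<tau> (g t) * ?K y t + \<sigma> * m / (2 * sqrt t) - amp q \<tau> (g t) * ?K y t)"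
      if t: "a < t" "t \<le> b" and y: "0 < y" "y < S t" for y t
    proof -
      have "0 < t" using t a by simp
      define \<eta> where "\<eta> = y / (2 * sqrt t)"
      define s where "s = slope q \<tau> (g t)"
      have "0 \<le> \<eta>" "\<eta> \<le> \<kappa>"
        using y bound[OF \<open>0 < t\<close>] \<open>0 < t\<close> by (auto simp: \<eta>_def field_simps)
      then have "heat_profile \<eta> \<le> heat_profile \<kappa>" by (rule heat_profile_mono)
      have "s / heat_profile (g t) \<le> \<bar>s\<bar> / heat_profile (g t)"
        using heat_profile_pos[of "g t"] by (intro divide_right_mono) auto
      also have "\<dots> \<le> \<bar>s\<bar> / 1"
        using heat_profile_ge_1[of "g t"] by (intro divide_left_mono) auto
      finally have "s / heat_profile (g t) * heat_profile \<eta> \<le> \<bar>s\<bar> * heat_profile \<kappa>"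
        using \<open>heat_profile \<eta> \<le> heat_profile \<kappa>\<close> less_imp_le[OF heat_profile_pos[of \<eta>]] by (intro mult_mono) auto
      then have "4 * \<epsilon> * (s / heat_profile (g t) * heat_profile \<eta>) \<le> 4 * \<epsilon> * (\<bar>s\<bar> * heat_profile \<kappa>)"
        using \<epsilon> by (intro mult_left_mono) auto
      also have "\<dots> \<le> m"
        using small[OF g_range[of t]] t unfolding s_def[symmetric] by (simp add: mult_ac)
      finally have "4 * \<epsilon> * (s / heat_profile (g t) * heat_profile \<eta>) \<le> m" .
      then have "0 \<le> (m - 4 * \<epsilon> * (s / heat_profile (g t) * heat_profile \<eta>)) / (2 * sqrt t)"
        using \<open>0 < t\<close> by simp
      also have "\<dots> = m / (2 * sqrt t) - s / heat_profile (g t) * \<epsilon> * (2 * heat_profile \<eta> / sqrt t)"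
        using \<open>0 < t\<close> by (simp add: field_simps)
      also have "2 * heat_profile \<eta> / sqrt t = heat y t / t"
        unfolding heat_def \<eta>_def using \<open>0 < t\<close> by (simp add: field_simps)
      also have "m / (2 * sqrt t) - s / heat_profile (g t) * \<epsilon> * (heat y t / t) =
        \<sigma> * \<sigma> * (m / (2 * sqrt t) - s / heat_profile (g t) * \<epsilon> * (heat y t / t))"
        unfolding \<sigma>\<sigma>(1) by simp
      also have "\<dots> = \<sigma> * (s / heat_profile (g t) * (- \<sigma> * \<epsilon> / t) * heat y t + \<sigma> * m / (2 * sqrt t))"
        by (simp add: right_diff_distrib distrib_left mult_ac)
      also have "\<dots> = \<sigma> * (slope q \<tau> (g t) / heat_profile (g t) * (- \<sigma> * \<epsilon> / t) * heat y t +
          amp q \<tau> (g t) * ?K y t + \<sigma> * m / (2 * sqrt t) - amp q \<tau> (g t) * ?K y t)"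
        unfolding s_def by (rule arg_cong[of _ _ "\<lambda>z. \<sigma> * z"]) linarith
      finally show ?thesis .
    qed
    show "0 \<le> \<sigma> * (?V (S t) t - Tm0 * sqrt t)"
      if t: "a < t" "t \<le> b" "0 \<le> \<sigma> * (2 * g t * sqrt t - S t)" for t
    proof -
      have "0 < t" using t a by simp
      define x where "x = S t / (2 * sqrt t)"
      have x: "0 \<le> x" "x \<le> \<kappa>"
        using S_pos[OF \<open>0 < t\<close>] bound[OF \<open>0 < t\<close>] \<open>0 < t\<close> by (auto simp: x_def field_simps)
      have "\<sigma> * (g t - x) = \<sigma> * (2 * g t * sqrt t - S t) / (2 * sqrt t)"
        using \<open>0 < t\<close> by (simp add: x_def field_simps)
      then have "0 \<le> \<sigma> * (g t - x)" using t(3) \<open>0 < t\<close> by simp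
      then have "0 \<le> \<sigma> * (amp q \<tau> (g t) * heat_profile x - q * x - (amp q \<tau> (g t) * heat_profile (g t) - q * g t))"
        using t by (intro decr g_range x) auto
      then have "0 \<le> 2 * sqrt t * (\<sigma> * (amp q \<tau> (g t) * heat_profile x - q * x -
          (amp q \<tau> (g t) * heat_profile (g t) - q * g t)))"
        by (rule mult_nonneg_nonneg[rotated]) (use \<open>0 < t\<close> in simp)
      also have "\<dots> = \<sigma> * (2 * sqrt t * (amp q \<tau> (g t) * heat_profile x - q * x) + \<sigma> * m * sqrt t -
          (2 * sqrt t * (amp q \<tau> (g t) * heat_profile (g t) - q * g t) + \<sigma> * m * sqrt t))"
        by (simp add: right_diff_distrib mult_ac)
      also have "\<dots> = \<sigma> * (?V (S t) t - Tm0 * sqrt t)"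
        by (simp only: melt profile_scaling[OF \<open>0 < t\<close>] x_def)
      finally show ?thesis .
    qed
    show "?V (2 * g t * sqrt t) t = Tm0 * sqrt t" if "a < t" for t
      using that a profile_at_front[of t q \<tau> "g t"] by (simp add: \<tau>_def algebra_simps)
    show "0 < \<sigma> * (L0 * sqrt t * ((g t - 2 * \<sigma> * \<epsilon>) / sqrt t) +
        (amp q \<tau> (g t) * serf (2 * g t * sqrt t / (2 * sqrt t)) - q))"
      if t: "a < t" "t \<le> b" for t
    proof -
      have "0 < t" using t a by simp
      then have "L0 * sqrt t * ((g t - 2 * \<sigma> * \<epsilon>) / sqrt t) = L0 * (g t - 2 * \<sigma> * \<epsilon>)"
        "2 * g t * sqrt t / (2 * sqrt t) = g t" by simp_all
      then have "\<sigma> * (L0 * sqrt t * ((g t - 2 * \<sigma> * \<epsilon>) / sqrt t) +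
          (amp q \<tau> (g t) * serf (2 * g t * sqrt t / (2 * sqrt t)) - q)) =
          \<sigma> * (L0 * g t - slope q \<tau> (g t)) - 2 * \<epsilon> * L0"
        by (simp only:) (simp add: slope_def algebra_simps \<sigma>\<sigma>)
      then show ?thesis using slack[OF g_range[of t]] t by simp
    qed
    show "0 < \<sigma> * (2 * g a * sqrt a - S a)"
      using S_init by (simp only: g_a)
    show "0 \<le> \<sigma> * (?V y a - T y a)" if "0 \<le> y" "y \<le> S a" for y
      using T_init[OF that] by (simp only: g_a)
    show "\<sigma> * (amp q \<tau> (g t) * serf (0 / (2 * sqrt t)) - q + q) \<le> 0" for t
      by simp
  qed (use a ab in simp_all)
  then show ?thesis by (simp add: g_b)
qed

end

section \<open>Uniqueness\<close>

lemma (in stefan) T_initially_small: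
  assumes "0 < e"
  shows "\<exists>d>0. \<forall>y t. 0 \<le> t \<longrightarrow> t < d \<longrightarrow> 0 \<le> y \<longrightarrow> y \<le> S t \<longrightarrow> \<bar>T y t\<bar> < e"
proof (rule T_small_near_corner[OF assms])
  fix d assume d: "0 < d" "\<And>y t. 0 \<le> t \<Longrightarrow> t < d \<Longrightarrow> 0 \<le> y \<Longrightarrow> y \<le> S t \<Longrightarrow> \<bar>T y t\<bar> < e"
  show ?thesis by (intro exI[of _ d] conjI allI impI d)
qed

text \<open>Both temperatures have the same boundary data on the same region. Starting at a small
  positive time, where each is below e / 2 in modulus, avoids the corner, and the shift by e pays
  for the unknown initial values.\<close>

lemma stefan_temperature_le:
  assumes "stefan q L0 Tm0 T Ty Tyy Tt S" "stefan q L0 Tm0 T' Ty' Tyy' Tt' S"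
    and "0 < t" "0 \<le> y" "y \<le> S t"
  shows "T y t \<le> T' y t"
proof (rule field_le_epsilon)
  fix e :: real assume "0 < e"
  interpret A: stefan q L0 Tm0 T Ty Tyy Tt S by fact
  interpret B: stefan q L0 Tm0 T' Ty' Tyy' Tt' S by fact
  have "0 < e / 2" using \<open>0 < e\<close> by simp
  obtain d where d: "0 < d"
    "\<forall>y t. 0 \<le> t \<longrightarrow> t < d \<longrightarrow> 0 \<le> y \<longrightarrow> y \<le> S t \<longrightarrow> \<bar>T y t\<bar> < e / 2"
    using A.T_initially_small[OF \<open>0 < e / 2\<close>] by blast
  obtain d' where d': "0 < d'"
    "\<forall>y t. 0 \<le> t \<longrightarrow> t < d' \<longrightarrow> 0 \<le> y \<longrightarrow> y \<le> S t \<longrightarrow> \<bar>T' y t\<bar> < e / 2"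
    using B.T_initially_small[OF \<open>0 < e / 2\<close>] by blast
  define a where "a = min t (min d d' / 2)"
  have a: "0 < a" "a \<le> t" "a < d" "a < d'"
    using d(1) d'(1) \<open>0 < t\<close> by (auto simp: a_def min_def)
  have "0 \<le> T' y t - T y t + e"
  proof (rule parabolic_minimum_principle[where w = "\<lambda>y t. T' y t - T y t + e" and S = S and a = a
        and b = t and wy = "\<lambda>y t. Ty' y t - Ty y t" and wyy = "\<lambda>y t. Tyy' y t - Tyy y t"
        and wt = "\<lambda>y t. Tt' y t - Tt y t"])
    show "continuous_on {(y, s). a \<le> s \<and> s \<le> t \<and> 0 \<le> y \<and> y \<le> S s} (\<lambda>(y, t). T' y t - T y t + e)"
      using A.T_cont_Icc[of a t] B.T_cont_Icc[of a t] a
      unfolding case_prod_unfold by (intro continuous_intros) auto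
    show "0 \<le> T' y a - T y a + e" if "0 \<le> y" "y \<le> S a" for y
    proof -
      have "\<bar>T y a\<bar> < e / 2" "\<bar>T' y a\<bar> < e / 2"
        using that a d(2) d'(2) by auto
      then show ?thesis by linarith
    qed
  next
    fix s assume s: "a < s" "s \<le> t"
    then have "0 < s" using a by simp
    show "0 \<le> T' (S s) s - T (S s) s + e"
      using \<open>0 < s\<close> \<open>0 < e\<close> by (simp add: A.T_melt B.T_melt)
    have "((\<lambda>y. T' y s - T y s + e) has_real_derivative Ty' 0 s - Ty 0 s + 0) (at 0 within {0..S s})"
      using A.S_pos[OF \<open>0 < s\<close>]
      by (intro DERIV_add DERIV_diff A.T_space B.T_space DERIV_const \<open>0 < s\<close>) auto
    then show "\<exists>D\<le>0. ((\<lambda>y. T' y s - T y s + e) has_real_derivative D) (at 0 within {0..S s})"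
      using \<open>0 < s\<close> by (auto simp: A.T_flux B.T_flux)
  next
    fix y s assume s: "a < s" "s \<le> t" and y: "0 < y" "y < S s"
    then have "0 < s" using a by simp
    show "((\<lambda>y. T' y s - T y s + e) has_real_derivative Ty' y s - Ty y s) (at y)"
      using DERIV_add[OF DERIV_diff[OF B.T_space_interior[OF \<open>0 < s\<close> y]
        A.T_space_interior[OF \<open>0 < s\<close> y]] DERIV_const[of e]] by simp
    show "((\<lambda>y. Ty' y s - Ty y s) has_real_derivative Tyy' y s - Tyy y s) (at y)"
      by (intro DERIV_diff A.T_space2 B.T_space2 \<open>0 < s\<close> y)
    show "((\<lambda>s. T' y s - T y s + e) has_real_derivative Tt' y s - Tt y s) (at s)"
      using DERIV_add[OF DERIV_diff[OF B.T_time[OF \<open>0 < s\<close> y]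
        A.T_time[OF \<open>0 < s\<close> y]] DERIV_const[of e]] by simp
    show "Tyy' y s - Tyy y s \<le> Tt' y s - Tt y s"
      using \<open>0 < s\<close> y by (simp add: A.T_heat B.T_heat)
  next
    show "continuous_on {a..t} S" using a(1) by (intro A.S_cont_Icc) simp
    show "0 < S s" if "a \<le> s" for s using that a(1) by (intro A.S_pos) simp
  qed (rule a(2) order_refl assms(4,5))+
  then show "T y t \<le> T' y t + e" by simp
qed

lemma (in stefan) T_corner: "T 0 0 = 0"
proof (rule ccontr)
  assume "T 0 0 \<noteq> 0"
  then have "0 < \<bar>T 0 0\<bar>" by simp
  from T_initially_small[OF this] obtain d where "0 < d"
    "\<forall>y t. 0 \<le> t \<longrightarrow> t < d \<longrightarrow> 0 \<le> y \<longrightarrow> y \<le> S t \<longrightarrow> \<bar>T y t\<bar> < \<bar>T 0 0\<bar>"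
    by blast
  from this(2)[rule_format, of 0 0] this(1) show False by (simp add: S_0)
qed

text \<open>For c <= 0 the function c * sqrt t decreases in time, so it is a subsolution; it has
  zero flux at y = 0 against the heating flux q, and c <= Tm0 orders the values at the
  front.\<close>

lemma (in stefan) T_lower_bound:
  assumes "0 < t" "0 \<le> y" "y \<le> S t"
  shows "min 0 Tm0 * sqrt t \<le> T y t"
proof (rule field_le_epsilon)
  fix e :: real assume "0 < e"
  define c where "c = min 0 Tm0"
  have c: "c \<le> 0" "c \<le> Tm0" by (auto simp: c_def)
  obtain d where d: "0 < d"
    "\<forall>y t. 0 \<le> t \<longrightarrow> t < d \<longrightarrow> 0 \<le> y \<longrightarrow> y \<le> S t \<longrightarrow> \<bar>T y t\<bar> < e"
    using T_initially_small[OF \<open>0 < e\<close>] by blast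
  define a where "a = min t (d / 2)"
  have a: "0 < a" "a \<le> t" "a < d"
    using d(1) \<open>0 < t\<close> by (auto simp: a_def min_def)
  have "0 \<le> T y t - c * sqrt t + e"
  proof (rule parabolic_minimum_principle[where w = "\<lambda>y t. T y t - c * sqrt t + e" and S = S and a = a
        and b = t and wy = Ty and wyy = Tyy and wt = "\<lambda>y t. Tt y t - c * (inverse (sqrt t) / 2)"])
    show "continuous_on {(y, s). a \<le> s \<and> s \<le> t \<and> 0 \<le> y \<and> y \<le> S s} (\<lambda>(y, t). T y t - c * sqrt t + e)"
      using T_cont_Icc[of a t] a
      unfolding case_prod_unfold by (intro continuous_intros) auto
    show "0 \<le> T y a - c * sqrt a + e" if "0 \<le> y" "y \<le> S a" for y
    proof -
      have "c * sqrt a \<le> 0" using c a by (intro mult_nonpos_nonneg) auto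
      moreover have "\<bar>T y a\<bar> < e" using that a d(2) by auto
      ultimately show ?thesis by linarith
    qed
  next
    fix s assume s: "a < s" "s \<le> t"
    then have "0 < s" using a by simp
    have "c * sqrt s \<le> Tm0 * sqrt s" using c \<open>0 < s\<close> by (intro mult_right_mono) auto
    then show "0 \<le> T (S s) s - c * sqrt s + e"
      using \<open>0 < s\<close> \<open>0 < e\<close> by (simp add: T_melt)
    have "((\<lambda>y. T y s - c * sqrt s + e) has_real_derivative Ty 0 s - 0 + 0) (at 0 within {0..S s})"
      using S_pos[OF \<open>0 < s\<close>]
      by (intro DERIV_add DERIV_diff T_space DERIV_const \<open>0 < s\<close>) auto
    then show "\<exists>D\<le>0. ((\<lambda>y. T y s - c * sqrt s + e) has_real_derivative D) (at 0 within {0..S s})"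
      using \<open>0 < s\<close> q_pos by (intro exI[of _ "- q"]) (simp add: T_flux)
  next
    fix y s assume s: "a < s" "s \<le> t" and y: "0 < y" "y < S s"
    then have "0 < s" using a by simp
    show "((\<lambda>y. T y s - c * sqrt s + e) has_real_derivative Ty y s) (at y)"
      using DERIV_add[OF DERIV_diff[OF T_space_interior[OF \<open>0 < s\<close> y]
        DERIV_const[of "c * sqrt s"]] DERIV_const[of e]] by simp
    show "((\<lambda>y. Ty y s) has_real_derivative Tyy y s) (at y)"
      by (intro T_space2 \<open>0 < s\<close> y)
    show "((\<lambda>s. T y s - c * sqrt s + e) has_real_derivative Tt y s - c * (inverse (sqrt s) / 2)) (at s)"
      using DERIV_add[OF DERIV_diff[OF T_time[OF \<open>0 < s\<close> y]
        DERIV_cmult[OF DERIV_real_sqrt[OF \<open>0 < s\<close>]]] DERIV_const[of e]] by simp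
    have "c * (inverse (sqrt s) / 2) \<le> 0" using c \<open>0 < s\<close> by (intro mult_nonpos_nonneg) auto
    then show "Tyy y s \<le> Tt y s - c * (inverse (sqrt s) / 2)"
      using \<open>0 < s\<close> y by (simp add: T_heat)
  next
    show "continuous_on {a..t} S" using a(1) by (intro S_cont_Icc) simp
    show "0 < S s" if "a \<le> s" for s using that a(1) by (intro S_pos) simp
  qed (rule a(2) order_refl assms(2,3))+
  then show "min 0 Tm0 * sqrt t \<le> T y t + e" by (simp add: c_def)
qed

section \<open>Bounds on the front from above and from below\<close>

locale stefan_gamma = stefan q L0 Tm0 T Ty Tyy Tt S + gamma_root q L0 Tm0 \<gamma>
  for q L0 Tm0 T Ty Tyy Tt S \<gamma>
begin

text \<open>The hypothesis of \<open>profile_antimono\<close> on nonnegative arguments. For a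
  nonnegative amplitude the worst case is x = g, where it is the sign of the slope; for a negative
  amplitude the left side is not positive.\<close>

lemma amp_serf_le:
  assumes "0 \<le> slope q \<tau> g" "0 \<le> x" "x \<le> g"
  shows "amp q \<tau> g * serf x \<le> q"
proof (cases "0 \<le> amp q \<tau> g")
  case True
  then have "amp q \<tau> g * serf x \<le> amp q \<tau> g * serf g"
    using serf_mono[OF assms(3)] by (rule mult_left_mono[rotated])
  with assms(1) show ?thesis by (simp add: slope_def)
next
  case False
  then have "amp q \<tau> g * serf x \<le> 0"
    using serf_mono[OF assms(2)] by (intro mult_nonpos_nonneg) auto
  then show ?thesis using q_pos by simp
qed

text \<open>With Tm0 > 0 every positive K has a nonnegative amplitude, so translated barriers exist
  for K arbitrarily close to \<gamma> and no drift is required. Continuity keeps the slope positive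
  there, since it equals L0 * \<gamma> at \<gamma>.\<close>

lemma S_le_pos:
  assumes "0 < Tm0" "0 < t"
  shows "S t \<le> 2 * \<gamma> * sqrt t"
proof (rule ccontr)
  assume "\<not> S t \<le> 2 * \<gamma> * sqrt t"
  then have "\<gamma> < S t / (2 * sqrt t)" using \<open>0 < t\<close> by (simp add: field_simps)
  then have "\<forall>\<^sub>F K in at_right \<gamma>. K \<in> {\<gamma><..<S t / (2 * sqrt t)}"
    by (rule eventually_at_right_real)
  moreover have "isCont (slope q Tm0) \<gamma>"
    using continuous_on_slope[of UNIV q Tm0] by (simp add: continuous_on_eq_continuous_at)
  then have "(slope q Tm0 \<longlongrightarrow> slope q Tm0 \<gamma>) (at_right \<gamma>)"
    using continuous_at_imp_continuous_at_within continuous_within by blast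
  then have "\<forall>\<^sub>F K in at_right \<gamma>. 0 < slope q Tm0 K"
    by (rule order_tendstoD(1)) (use slope_gamma gamma_pos L0_pos in simp)
  ultimately have "\<forall>\<^sub>F K in at_right \<gamma>. K \<in> {\<gamma><..<S t / (2 * sqrt t)} \<and> 0 < slope q Tm0 K"
    by (rule eventually_conj)
  from eventually_happens'[OF trivial_limit_at_right_real this]
  obtain K where K: "\<gamma> < K" "K < S t / (2 * sqrt t)" "0 < slope q Tm0 K" by auto
  have "0 \<le> amp q Tm0 K"
    unfolding amp_def using assms K(1) q_pos gamma_pos by (intro divide_nonneg_pos) auto
  then have "S t \<le> 2 * K * sqrt t"
    using K slope_less assms by (intro shifted_barrier) auto
  then show False using K(2) \<open>0 < t\<close> by (simp add: field_simps)
qed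

text \<open>
  The shift needs a nonnegative amplitude, so for \<open>Tm0 \<le> 0\<close> it only gives a crude bound, from which
  a quasi-stationary barrier descends to \<open>\<gamma>'\<close>.
\<close>
lemma S_less_nonpos:
  assumes "Tm0 \<le> 0" "0 < b" "\<gamma> < \<gamma>'"
  shows "S b < 2 * \<gamma>' * sqrt b"
proof -
  \<comment> \<open>The second entry makes the amplitude nonnegative, the first places K above
    \<gamma>'.\<close>
  define K where "K = max (\<gamma>' + 1) (- Tm0 / (2 * q))"
  have K: "\<gamma>' < K" "\<gamma> < K" "0 < K" using assms gamma_pos by (auto simp: K_def)
  have "- Tm0 / (2 * q) \<le> K" by (simp add: K_def)
  then have "0 \<le> Tm0 / 2 + q * K" using q_pos by (simp add: field_simps)
  then have ampl: "0 \<le> amp q Tm0 K" "0 \<le> amp q Tm0 (K + 1)"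
    unfolding amp_def using q_pos by (auto intro!: divide_nonneg_pos simp: algebra_simps)
  have slope_pos: "0 \<le> slope q \<tau> g" if "\<tau> \<le> 0" "0 \<le> g" for \<tau> g
  proof -
    have "\<tau> / 2 * serf g \<le> 0"
      using that serf_mono[of 0 g] by (intro mult_nonpos_nonneg) auto
    moreover have "0 \<le> q * exp (- g\<^sup>2)" using q_pos by simp
    ultimately show ?thesis unfolding slope_eq by (intro divide_nonneg_pos) auto
  qed
  have S_le: "S t \<le> 2 * K * sqrt t" if "0 < t" for t
    by (rule shifted_barrier(1)[OF ampl(1) slope_pos[OF assms(1) less_imp_le[OF K(3)]]
        slope_less[OF K(2)] that])
  have T_le: "T y t \<le> amp q Tm0 (K + 1) * heat y t - q * y" if "0 < t" "0 \<le> y" "y \<le> S t" for y t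
    by (rule shifted_barrier(2)[OF ampl(2) _ _ that])
       (use slope_pos[OF assms(1)] slope_less K in auto)
  have S_le': "S t \<le> 2 * (K + 1) * sqrt t" "S t < 2 * (K + 1) * sqrt t" if "0 < t" for t
  proof -
    have "2 * (K + 1) * sqrt t = 2 * K * sqrt t + 2 * sqrt t" by (simp add: algebra_simps)
    moreover have "0 < sqrt t" using that by simp
    ultimately show "S t \<le> 2 * (K + 1) * sqrt t" "S t < 2 * (K + 1) * sqrt t"
      using S_le[OF that] by linarith+
  qed
  \<comment> \<open>Starting the drift at K + 1 instead of K turns the weak bound on S a into the
    strict initial inequality.\<close>
  obtain m \<epsilon> where m: "0 < m" "m < 1" and \<epsilon>: "0 < \<epsilon>"
    "\<And>g. \<gamma>' \<le> g \<Longrightarrow> g \<le> K + 1 \<Longrightarrow> 2 * \<epsilon> * L0 < 1 * (L0 * g - slope q (Tm0 - 1 * m) g)"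
    "\<And>g. \<gamma>' \<le> g \<Longrightarrow> g \<le> K + 1 \<Longrightarrow> 4 * \<epsilon> * \<bar>slope q (Tm0 - 1 * m) g\<bar> * heat_profile (K + 1) \<le> m"
  proof (rule quasi_stationary_parameters[of q L0 1 1 \<gamma>' "K + 1" Tm0 "K + 1"])
    show "0 < 1 * (L0 * g - slope q Tm0 g)" if "\<gamma>' \<le> g" for g
      using slope_less[of g] that assms by simp
  qed (use q_pos L0_pos in auto)
  define a where "a = b / exp (1 * (K + 1 - \<gamma>') / \<epsilon>)"
  have a: "0 < a" "a * exp (1 * (K + 1 - \<gamma>') / \<epsilon>) = b" using assms by (auto simp: a_def)
  have "0 < 1 * (2 * \<gamma>' * sqrt (a * exp (1 * (K + 1 - \<gamma>') / \<epsilon>)) - S (a * exp (1 * (K + 1 - \<gamma>') / \<epsilon>)))"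
  proof (rule quasi_stationary_barrier[where \<sigma> = 1 and \<kappa> = "K + 1" and m = m])
    show "0 \<le> 1 * (amp q (Tm0 - 1 * m) g * heat_profile x - q * x - (amp q (Tm0 - 1 * m) g * heat_profile g - q * g))"
      if "0 \<le> 1 * (K + 1 - g)" "0 \<le> 1 * (g - \<gamma>')" "0 \<le> x" "0 \<le> 1 * (g - x)" for g x
    proof -
      have "0 \<le> slope q (Tm0 - 1 * m) g"
        using that m assms gamma_pos by (intro slope_pos) auto
      from amp_serf_le[OF this]
      have "amp q (Tm0 - 1 * m) g * heat_profile g - q * g \<le> amp q (Tm0 - 1 * m) g * heat_profile x - q * x"
        using that by (intro profile_antimono) auto
      then show ?thesis by simp
    qed
    show "0 \<le> 1 * (amp q (Tm0 - 1 * m) (K + 1) * heat y a - q * y + 1 * m * sqrt a - T y a)"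
      if y: "0 \<le> y" "y \<le> S a" for y
    proof -
      \<comment> \<open>Replacing Tm0 by Tm0 - m lowers the amplitude by m / (2 * heat_profile (K +
        1)), hence the barrier by at most m * sqrt a, which the added term returns.\<close>
      have "heat_profile (y / (2 * sqrt a)) \<le> heat_profile (K + 1)"
        using y S_le'(1)[of a] a by (intro heat_profile_mono) (auto simp: field_simps)
      then have "heat y a \<le> 2 * sqrt a * heat_profile (K + 1)"
        using a by (simp add: heat_def)
      then have "m / 2 * heat y a / heat_profile (K + 1) \<le> m * sqrt a"
        using m by (simp add: field_simps)
      moreover have "amp q (Tm0 - 1 * m) (K + 1) * heat y a =
          amp q Tm0 (K + 1) * heat y a - m / 2 * heat y a / heat_profile (K + 1)"
        by (simp add: amp_def field_simps)
      ultimately show ?thesis using T_le[of a y] y a by simp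
    qed
    show "2 * \<epsilon> * L0 < 1 * (L0 * g - slope q (Tm0 - 1 * m) g)"
      if "0 \<le> 1 * (K + 1 - g)" "0 \<le> 1 * (g - \<gamma>')" for g
      using that by (intro \<epsilon>(2)) auto
    show "4 * \<epsilon> * \<bar>slope q (Tm0 - 1 * m) g\<bar> * heat_profile (K + 1) \<le> m"
      if "0 \<le> 1 * (K + 1 - g)" "0 \<le> 1 * (g - \<gamma>')" for g
      using that by (intro \<epsilon>(3)) auto
    show "0 < 1 * (2 * (K + 1) * sqrt a - S a)"
      using S_le'(2)[OF a(1)] by simp
    show "0 \<le> 1 * (K + 1 - \<gamma>')" using K by simp
    show "S t \<le> 2 * (K + 1) * sqrt t" if "0 < t" for t
      by (rule S_le'(1)[OF that])
  qed (simp_all add: m \<epsilon>(1) a(1))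
  then show ?thesis unfolding a by simp
qed

lemma S_le:
  assumes "0 < t"
  shows "S t \<le> 2 * \<gamma> * sqrt t"
proof (cases "0 < Tm0")
  case False
  show ?thesis
  proof (rule field_le_epsilon)
    fix e :: real assume "0 < e"
    have "S t < 2 * (\<gamma> + e / (2 * sqrt t)) * sqrt t"
      using False assms \<open>0 < e\<close> by (intro S_less_nonpos) auto
    also have "\<dots> = 2 * \<gamma> * sqrt t + e"
      using assms by (simp add: field_simps)
    finally show "S t \<le> 2 * \<gamma> * sqrt t + e" by simp
  qed
qed (rule S_le_pos[OF _ assms])

text \<open>The profile of \<gamma> decreases between g and \<gamma>, so at g it is still at least
  Tm0 / 2, the value which the profile of g has there. For negative g the decrease needs a
  nonnegative amplitude, hence the condition on Tm0.\<close>

lemma amp_le_amp_gamma: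
  assumes "g \<le> \<gamma>" "0 \<le> g \<or> 0 \<le> Tm0"
  shows "amp q Tm0 g \<le> amp q Tm0 \<gamma>"
proof -
  have "amp q Tm0 \<gamma> * serf x \<le> q" if "g \<le> x" "x \<le> \<gamma>" for x
  proof (cases "0 \<le> x")
    case True
    then show ?thesis
      using that slope_gamma gamma_pos L0_pos by (intro amp_serf_le) auto
  next
    case False
    then have "0 \<le> amp q Tm0 \<gamma>"
      unfolding amp_def using assms that gamma_pos q_pos by (intro divide_nonneg_pos) auto
    then have "amp q Tm0 \<gamma> * serf x \<le> 0"
      using serf_mono[of x 0] False by (intro mult_nonneg_nonpos) auto
    then show ?thesis using q_pos by simp
  qed
  from profile_antimono[OF assms(1), of "amp q Tm0 \<gamma>" q, OF this]
  have "Tm0 / 2 + q * g \<le> amp q Tm0 \<gamma> * heat_profile g" by (simp add: amp_times_heat_profile)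
  then show ?thesis by (simp add: amp_def[of q Tm0 g] field_simps)
qed

text \<open>
  For \<open>Tm0 \<ge> 0\<close> the front coefficient starts at a negative value where the amplitude vanishes,
  since initially only \<open>T \<ge> 0\<close> is known, not \<open>T \<ge> Tm0 \<surd>t\<close>.
\<close>
lemma S_greater:
  assumes "0 < b" "0 < \<gamma>'" "\<gamma>' < \<gamma>"
  shows "2 * \<gamma>' * sqrt b < S b"
proof -
  \<comment> \<open>m < L0 keeps the perturbed profile decreasing up to \<gamma>; for Tm0 < 0, m < -
    Tm0 keeps the initial amplitude negative.\<close>
  define m0 where "m0 = min L0 (if Tm0 < 0 then - Tm0 else 1)"
  \<comment> \<open>For Tm0 >= 0 this is the zero of \<open>amp q (Tm0 + m)\<close>. It depends on
    m, so the parameters are chosen on the larger range that begins at start m0.\<close>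
  define start where "start m = (if Tm0 < 0 then 0 else - (Tm0 + m) / (2 * q))" for m
  have "0 < m0" using L0_pos by (auto simp: m0_def)
  have slack: "0 < - 1 * (L0 * g - slope q Tm0 g)" if "start m0 \<le> g" "g \<le> \<gamma>'" for g
  proof (cases "0 \<le> g")
    case True
    then show ?thesis using slope_greater[of g] that assms by simp
  next
    case False
    then have "0 \<le> Tm0" using that by (auto simp: start_def split: if_splits)
    then have "Tm0 / 2 * serf g \<le> 0"
      using False serf_mono[of g 0] by (intro mult_nonneg_nonpos) auto
    moreover have "0 < q * exp (- g\<^sup>2)" using q_pos by simp
    ultimately have "0 < slope q Tm0 g"
      unfolding slope_eq by (intro divide_pos_pos) auto
    moreover have "L0 * g \<le> 0" using False L0_pos by (intro mult_nonneg_nonpos) auto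
    ultimately show ?thesis by simp
  qed
  obtain m \<epsilon> where m: "0 < m" "m < m0" and \<epsilon>: "0 < \<epsilon>"
    "\<And>g. start m0 \<le> g \<Longrightarrow> g \<le> \<gamma>' \<Longrightarrow> 2 * \<epsilon> * L0 < - 1 * (L0 * g - slope q (Tm0 - (- 1) * m) g)"
    "\<And>g. start m0 \<le> g \<Longrightarrow> g \<le> \<gamma>' \<Longrightarrow> 4 * \<epsilon> * \<bar>slope q (Tm0 - (- 1) * m) g\<bar> * heat_profile \<gamma> \<le> m"
    by (rule quasi_stationary_parameters[of q L0 "- 1" m0 "start m0" \<gamma>' Tm0 \<gamma>])
       (use q_pos L0_pos \<open>0 < m0\<close> slack in auto)
  have start: "start m0 \<le> start m" "start m \<le> 0"
    using m q_pos by (auto simp: start_def field_simps)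
  have "m \<le> L0" using m by (simp add: m0_def)
  define a where "a = b / exp (- 1 * (start m - \<gamma>') / \<epsilon>)"
  have a: "0 < a" "a * exp (- 1 * (start m - \<gamma>') / \<epsilon>) = b" using assms by (auto simp: a_def)
  have "0 < - 1 * (2 * \<gamma>' * sqrt (a * exp (- 1 * (start m - \<gamma>') / \<epsilon>)) - S (a * exp (- 1 * (start m - \<gamma>') / \<epsilon>)))"
  proof (rule quasi_stationary_barrier[where \<sigma> = "- 1" and \<kappa> = \<gamma> and m = m])
    show "0 \<le> - 1 * (amp q (Tm0 - (- 1) * m) g * heat_profile x - q * x -
        (amp q (Tm0 - (- 1) * m) g * heat_profile g - q * g))"
      if g: "0 \<le> - 1 * (start m - g)" "0 \<le> - 1 * (g - \<gamma>')" and x: "0 \<le> x" "x \<le> \<gamma>" "0 \<le> - 1 * (g - x)"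
      for g x
    proof -
      define c where "c = amp q (Tm0 + m) g"
      \<comment> \<open>The perturbation raises the amplitude by at most m / 2. Since
        \<open>slope q Tm0 \<gamma>\<close> equals L0 * \<gamma>, there is room for the extra m / 2
        * serf \<gamma> <= L0 * \<gamma>.\<close>
      have "c = amp q Tm0 g + m / 2 / heat_profile g" by (simp add: c_def amp_def field_simps)
      moreover have "m / 2 / heat_profile g \<le> m / 2"
        using m heat_profile_ge_1[of g] by (simp add: field_simps)
      moreover have "amp q Tm0 g \<le> amp q Tm0 \<gamma>"
        using g assms by (intro amp_le_amp_gamma) (auto simp: start_def split: if_splits)
      ultimately have "c * serf \<gamma> \<le> (amp q Tm0 \<gamma> + m / 2) * serf \<gamma>"
        using serf_pos[OF gamma_pos] by (intro mult_right_mono) auto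
      also have "\<dots> = q - L0 * \<gamma> + m / 2 * serf \<gamma>"
        using slope_gamma by (simp add: slope_def algebra_simps)
      also have "m / 2 * serf \<gamma> \<le> L0 / 2 * (2 * \<gamma>)"
        using m \<open>m \<le> L0\<close> serf_le[of \<gamma>] serf_pos[of \<gamma>] gamma_pos by (intro mult_mono) auto
      finally have c_gamma: "c * serf \<gamma> \<le> q" by simp
      have "c * serf z \<le> q" if z: "g \<le> z" "z \<le> x" for z
      proof (cases "0 \<le> c")
        case True
        then have "c * serf z \<le> c * serf \<gamma>"
          using z x by (intro mult_left_mono serf_mono) auto
        with c_gamma show ?thesis by simp
      next
        case False
        have "0 \<le> z"
        proof (rule ccontr)
          assume "\<not> 0 \<le> z"
          then have "\<not> Tm0 < 0" using z g by (auto simp: start_def)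
          then have "0 \<le> (Tm0 + m) / 2 + q * g"
            using g q_pos by (simp add: start_def field_simps)
          then show False using False by (simp add: c_def amp_def)
        qed
        then have "c * serf z \<le> 0"
          using False serf_mono[of 0 z] by (intro mult_nonpos_nonneg) auto
        then show ?thesis using q_pos by simp
      qed
      from profile_antimono[of g x c q, OF _ this] x show ?thesis
        by (simp add: c_def)
    qed
    show "0 \<le> - 1 * (amp q (Tm0 - (- 1) * m) (start m) * heat y a - q * y + - 1 * m * sqrt a - T y a)"
      if y: "0 \<le> y" "y \<le> S a" for y
    proof -
      have "0 \<le> q * y" using q_pos y by simp
      note low = T_lower_bound[OF a(1) y]
      show ?thesis
      \<comment> \<open>If Tm0 < 0, the amplitude is negative and heat y a >= 2 * sqrt a pushes the
        barrier below Tm0 * sqrt a. Otherwise the amplitude is 0 and the barrier is not positive,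
        while T is nonnegative.\<close>
      proof (cases "Tm0 < 0")
        case True
        then have "m < - Tm0" using m by (simp add: m0_def)
        have "2 * sqrt a * 1 \<le> heat y a"
          unfolding heat_def using heat_profile_ge_1 a by (intro mult_left_mono) auto
        then have "(Tm0 + m) / 2 * heat y a \<le> (Tm0 + m) / 2 * (2 * sqrt a * 1)"
          using \<open>m < - Tm0\<close> by (intro mult_left_mono_neg) auto
        also have "\<dots> = Tm0 * sqrt a + m * sqrt a" by (simp add: algebra_simps)
        finally have "amp q (Tm0 - (- 1) * m) (start m) * heat y a \<le> Tm0 * sqrt a + m * sqrt a"
          using True by (simp add: start_def amp_def)
        moreover have "Tm0 * sqrt a \<le> T y a" using low True by simp
        ultimately show ?thesis using \<open>0 \<le> q * y\<close> by simp
      next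
        case False
        then have "amp q (Tm0 + m) (start m) = 0"
          using q_pos by (simp add: start_def amp_def field_simps)
        moreover have "0 \<le> m * sqrt a" using m a by simp
        ultimately show ?thesis using False low \<open>0 \<le> q * y\<close> by simp
      qed
    qed
    have "start m * sqrt a \<le> 0" using start a by (intro mult_nonpos_nonneg) auto
    then show "0 < - 1 * (2 * start m * sqrt a - S a)" using S_pos[OF a(1)] by simp
    show "2 * \<epsilon> * L0 < - 1 * (L0 * g - slope q (Tm0 - (- 1) * m) g)"
      if "0 \<le> - 1 * (start m - g)" "0 \<le> - 1 * (g - \<gamma>')" for g
      using that start by (intro \<epsilon>(2)) auto
    show "4 * \<epsilon> * \<bar>slope q (Tm0 - (- 1) * m) g\<bar> * heat_profile \<gamma> \<le> m"
      if "0 \<le> - 1 * (start m - g)" "0 \<le> - 1 * (g - \<gamma>')" for g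
      using that start by (intro \<epsilon>(3)) auto
    show "0 \<le> - 1 * (start m - \<gamma>')" using start assms by simp
    show "S t \<le> 2 * \<gamma> * sqrt t" if "0 < t" for t
      by (rule S_le[OF that])
  qed (simp_all add: m \<epsilon>(1) a(1))
  then show ?thesis unfolding a by simp
qed

lemma S_eq:
  assumes "0 \<le> t"
  shows "S t = explicit_S \<gamma> t"
proof (cases "t = 0")
  case False
  then have "0 < t" using assms by simp
  have "2 * \<gamma> * sqrt t \<le> S t"
  proof (rule field_le_epsilon)
    fix e :: real assume "0 < e"
    \<comment> \<open>The entry \<gamma> / 2 only keeps the coefficient positive when e is
      large.\<close>
    define \<gamma>' where "\<gamma>' = max (\<gamma> / 2) (\<gamma> - e / (2 * sqrt t))"
    have "0 < \<gamma>'" "\<gamma>' < \<gamma>" using gamma_pos \<open>0 < e\<close> \<open>0 < t\<close> by (auto simp: \<gamma>'_def)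
    then have "2 * \<gamma>' * sqrt t < S t" by (intro S_greater \<open>0 < t\<close>)
    moreover have "2 * (\<gamma> - e / (2 * sqrt t)) * sqrt t \<le> 2 * \<gamma>' * sqrt t"
      using \<open>0 < t\<close> by (intro mult_right_mono mult_left_mono) (auto simp: \<gamma>'_def)
    moreover have "2 * (\<gamma> - e / (2 * sqrt t)) * sqrt t = 2 * \<gamma> * sqrt t - e"
      using \<open>0 < t\<close> by (simp add: field_simps)
    ultimately show "2 * \<gamma> * sqrt t \<le> S t + e" by simp
  qed
  with S_le[OF \<open>0 < t\<close>] show ?thesis by (simp add: explicit_S_def)
qed (simp add: S_0 explicit_S_def)

end

section \<open>The explicit solution\<close>

context gamma_root
begin

text \<open>The formula is singular at t = 0, but the region meets t = 0 only in the corner, and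
  below the front |T| <= M * sqrt t because the similarity variable stays below \<gamma>.\<close>

lemma explicit_T_continuous:
  "continuous_on {(y, t). 0 \<le> t \<and> 0 \<le> y \<and> y \<le> explicit_S \<gamma> t} (\<lambda>(y, t). explicit_T q L0 \<gamma> y t)"
  (is "continuous_on ?D _")
proof -
  define A where "A = amp q Tm0 \<gamma>"
  define f where "f p = A * heat (fst p) (snd p) - q * fst p" for p :: "real \<times> real"
  define M where "M = \<bar>A\<bar> * (2 * heat_profile \<gamma>) + q * (2 * \<gamma>)"
  have bound: "\<bar>f p\<bar> \<le> M * sqrt (snd p)" if "p \<in> ?D" for p
  proof -
    obtain y t where p: "p = (y, t)" by (cases p)
    have t: "0 \<le> t" and y: "0 \<le> y" "y \<le> 2 * \<gamma> * sqrt t"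
      using that by (auto simp: p explicit_S_def)
    have "heat_profile (y / (2 * sqrt t)) \<le> heat_profile \<gamma>"
    proof (cases "t = 0")
      case False
      then show ?thesis using t y by (intro heat_profile_mono) (auto simp: field_simps)
    qed (use heat_profile_ge_1[of \<gamma>] in simp)
    then have "heat y t \<le> 2 * heat_profile \<gamma> * sqrt t"
      using t mult_left_mono[of "heat_profile (y / (2 * sqrt t))" "heat_profile \<gamma>" "2 * sqrt t"]
      by (simp add: heat_def mult_ac)
    then have "\<bar>A\<bar> * heat y t \<le> \<bar>A\<bar> * (2 * heat_profile \<gamma> * sqrt t)"
      by (intro mult_left_mono) auto
    moreover have "q * y \<le> q * (2 * \<gamma> * sqrt t)"
      using y q_pos by (intro mult_left_mono) auto
    moreover have "\<bar>f p\<bar> \<le> \<bar>A * heat y t\<bar> + \<bar>q * y\<bar>"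
      by (simp add: f_def p abs_triangle_ineq4)
    moreover have "\<bar>A * heat y t\<bar> = \<bar>A\<bar> * heat y t" "\<bar>q * y\<bar> = q * y"
      using heat_nonneg[OF t, of y] q_pos y by (auto simp: abs_mult)
    ultimately show ?thesis by (simp add: M_def p algebra_simps)
  qed
  have "continuous (at p within ?D) f" if "p \<in> ?D" for p
  proof (cases "snd p = 0")
    case True
    then have "f p = 0" using bound[OF that] by simp
    have "((\<lambda>r. M * sqrt (snd r)) \<longlongrightarrow> M * sqrt (snd p)) (at p within ?D)"
      by (intro tendsto_intros)
    then have "((\<lambda>r. M * sqrt (snd r)) \<longlongrightarrow> 0) (at p within ?D)"
      by (simp add: True)
    then have "(f \<longlongrightarrow> 0) (at p within ?D)"
      by (rule Lim_null_comparison[rotated]) (use bound in \<open>auto simp: eventually_at_filter\<close>)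
    then show ?thesis by (simp add: continuous_within \<open>f p = 0\<close>)
  next
    case False
    define U where "U = {p :: real \<times> real. 0 < snd p}"
    have "p \<in> U" using that False by (auto simp: U_def)
    have "open U" unfolding U_def by (intro open_Collect_less continuous_intros)
    moreover have "continuous_on U f"
      unfolding f_def by (intro continuous_intros) (simp add: U_def)
    ultimately have "isCont f p"
      using \<open>p \<in> U\<close> continuous_on_eq_continuous_at by blast
    then show ?thesis by (rule continuous_at_imp_continuous_at_within)
  qed
  then have "continuous_on ?D f" by (simp add: continuous_on_eq_continuous_within)
  then show ?thesis
    by (rule continuous_on_eq) (auto simp: f_def A_def explicit_T_eq)
qed

lemma explicit_solution:
  "stefan_solution q L0 Tm0 (explicit_T q L0 \<gamma>) (explicit_S \<gamma>)"
proof -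
  define A where "A = amp q Tm0 \<gamma>"
  define Ty where "Ty y t = A * serf (y / (2 * sqrt t)) - q" for y t
  define K where "K y t = A * (exp (- (y / (2 * sqrt t))\<^sup>2) / sqrt t)" for y t
  have S_deriv: "(explicit_S \<gamma> has_real_derivative \<gamma> / sqrt t) (at t)" if "0 < t" for t
    unfolding explicit_S_def[abs_def]
    by (rule DERIV_cong[OF DERIV_cmult[OF DERIV_real_sqrt[OF that]]]) (simp add: inverse_eq_divide)
  have T_eq: "explicit_T q L0 \<gamma> y t = A * heat y t - q * y" if "0 < t" for y t
    using explicit_T_eq that by (simp add: A_def)
  have T_space: "((\<lambda>y. explicit_T q L0 \<gamma> y t) has_real_derivative Ty y t) (at y)" if "0 < t" for y t
    unfolding T_eq[OF that] Ty_def
    by (rule DERIV_cong[OF DERIV_diff[OF DERIV_cmult[OF heat_deriv_space[OF that]]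
          DERIV_cmult[OF DERIV_ident]]]) simp
  have T_space2: "((\<lambda>y. Ty y t) has_real_derivative K y t) (at y)" if "0 < t" for y t
    unfolding Ty_def K_def
    by (rule DERIV_cong[OF DERIV_diff[OF DERIV_cmult[OF heat_deriv_space2[OF that]] DERIV_const]]) simp
  have T_time: "((\<lambda>t. explicit_T q L0 \<gamma> y t) has_real_derivative K y t) (at t)" if "0 < t" for y t
  proof (rule has_field_derivative_transform_within_open[where S = "{0<..}"])
    show "((\<lambda>t. A * heat y t - q * y) has_real_derivative K y t) (at t)"
      unfolding K_def
      by (rule DERIV_cong[OF DERIV_diff[OF DERIV_cmult[OF heat_deriv_time[OF that]] DERIV_const]]) simp
  qed (use that T_eq in auto)
  have Ty_cont: "continuous_on {(y, t). 0 < t \<and> 0 \<le> y \<and> y \<le> explicit_S \<gamma> t} (\<lambda>(y, t). Ty y t)"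
    unfolding Ty_def case_prod_unfold by (intro continuous_intros) auto
  have K_cont: "continuous_on {(y, t). 0 < t \<and> 0 < y \<and> y < explicit_S \<gamma> t} (\<lambda>(y, t). K y t)"
    unfolding K_def case_prod_unfold by (intro continuous_intros) auto
  have front: "explicit_S \<gamma> t / (2 * sqrt t) = \<gamma>" if "0 < t" for t
    using that by (simp add: explicit_S_def)
  have stefan: "- Ty (explicit_S \<gamma> t) t = L0 * sqrt t * deriv (explicit_S \<gamma>) t" if "0 < t" for t
    using slope_gamma that unfolding Ty_def front[OF that] DERIV_imp_deriv[OF S_deriv[OF that]]
    by (simp add: slope_def A_def)
  have melt: "explicit_T q L0 \<gamma> (explicit_S \<gamma> t) t = Tm0 * sqrt t" if "0 < t" for t
    using profile_at_front[OF that, of q Tm0 \<gamma>] by (simp add: T_eq[OF that] A_def explicit_S_def)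
  show ?thesis
    unfolding stefan_solution_def
  proof (intro conjI)
    show "continuous_on {0..} (explicit_S \<gamma>)"
      unfolding explicit_S_def by (intro continuous_intros)
    show "\<forall>t>0. 0 < explicit_S \<gamma> t \<and> explicit_S \<gamma> differentiable at t"
      using S_deriv gamma_pos real_differentiable_def by (auto simp: explicit_S_def)
  qed (rule explicit_T_continuous, rule exI[of _ Ty], rule exI[of _ K], rule exI[of _ K],
      simp add: has_field_derivative_at_within[OF T_space] T_space2 T_time Ty_cont K_cont stefan melt,
      simp add: Ty_def explicit_S_def)
qed

end

text \<open>Once the front is known, the explicit temperature also solves the problem with front S,
  and comparing the two temperatures in both directions gives equality.\<close>

lemma (in stefan_gamma) T_eq:
  assumes "0 \<le> t" "0 \<le> y" "y \<le> S t"
  shows "T y t = explicit_T q L0 \<gamma> y t"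
proof -
  obtain Ty' Tyy' Tt' where "stefan q L0 Tm0 (explicit_T q L0 \<gamma>) Ty' Tyy' Tt' (explicit_S \<gamma>)"
    using stefan_solution_imp_stefan[OF q_pos L0_pos explicit_solution] by blast
  then interpret E: stefan q L0 Tm0 "explicit_T q L0 \<gamma>" Ty' Tyy' Tt' "explicit_S \<gamma>" .
  have E': "stefan q L0 Tm0 (explicit_T q L0 \<gamma>) Ty' Tyy' Tt' S"
  proof unfold_locales
    show "S differentiable at t" if "0 < t" for t by (rule S_diff[OF that])
    show "- Ty' (S t) t = L0 * sqrt t * deriv S t" if "0 < t" for t
    proof -
      \<comment> \<open>The fronts are known to agree only for nonnegative times, so the derivative
        is transferred on the open half-line.\<close>
      have "(explicit_S \<gamma> has_real_derivative deriv S t) (at t)"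
        by (rule has_field_derivative_transform_within_open[OF S_deriv[OF that], where S = "{0<..}"])
           (use that S_eq in auto)
      then show ?thesis
        using E.T_stefan[OF that] S_eq[of t] that by (simp add: DERIV_imp_deriv)
    qed
    have eq: "{(y, t). 0 \<le> t \<and> 0 \<le> y \<and> y \<le> S t} = {(y, t). 0 \<le> t \<and> 0 \<le> y \<and> y \<le> explicit_S \<gamma> t}"
      using S_eq by auto
    show "continuous_on {(y, t). 0 \<le> t \<and> 0 \<le> y \<and> y \<le> S t} (\<lambda>(y, t). explicit_T q L0 \<gamma> y t)"
      unfolding eq by (rule E.T_cont)
  qed (use S_cont S_pos S_0 E.T_space E.T_space2 E.T_time E.T_heat E.T_melt E.T_flux in
      \<open>simp_all add: S_eq less_imp_le\<close>)
  show ?thesis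
  proof (cases "t = 0")
    case True
    then have "y = 0" using assms S_0 by simp
    then show ?thesis using True T_corner E.T_corner by simp
  next
    case False
    then have "0 < t" using assms by simp
    have S': "stefan q L0 Tm0 T Ty Tyy Tt S" by unfold_locales
    show ?thesis
      using stefan_temperature_le[OF S' E' \<open>0 < t\<close> assms(2,3)]
        stefan_temperature_le[OF E' S' \<open>0 < t\<close> assms(2,3)] by simp
  qed
qed

theorem theorem4p1:
  fixes q L0 Tm0 :: real
  assumes "q > 0" and "L0 > 0" and "L0 > Tm0"
  shows "(\<exists>!\<gamma>. \<gamma> > 0 \<and> gamma_eq q L0 Tm0 \<gamma>) \<and>
    (\<forall>\<gamma>. \<gamma> > 0 \<and> gamma_eq q L0 Tm0 \<gamma> \<longrightarrow>
       stefan_solution q L0 Tm0 (explicit_T q L0 \<gamma>) (explicit_S \<gamma>) \<and>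
       (\<forall>T S. stefan_solution q L0 Tm0 T S \<longrightarrow>
          (\<forall>t\<ge>0. S t = explicit_S \<gamma> t) \<and>
          (\<forall>t\<ge>0. \<forall>y. 0 \<le> y \<and> y \<le> S t \<longrightarrow> T y t = explicit_T q L0 \<gamma> y t)))"
proof (intro conjI[OF ex1_gamma[OF assms(1,2)]] allI impI, elim conjE)
  fix \<gamma> :: real assume \<gamma>: "0 < \<gamma>" "gamma_eq q L0 Tm0 \<gamma>"
  then interpret gamma_root q L0 Tm0 \<gamma>
    using assms by unfold_locales
  have unique: "(\<forall>t\<ge>0. S t = explicit_S \<gamma> t) \<and>
      (\<forall>t\<ge>0. \<forall>y. 0 \<le> y \<and> y \<le> S t \<longrightarrow> T y t = explicit_T q L0 \<gamma> y t)"
    if sol: "stefan_solution q L0 Tm0 T S" for T S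
  proof -
    obtain Ty Tyy Tt where st: "stefan q L0 Tm0 T Ty Tyy Tt S"
      using stefan_solution_imp_stefan[OF assms(1,2) sol] by blast
    interpret S: stefan q L0 Tm0 T Ty Tyy Tt S by (rule st)
    interpret S: stefan_gamma q L0 Tm0 T Ty Tyy Tt S \<gamma> by unfold_locales
    show ?thesis using S.S_eq S.T_eq by blast
  qed
  show "stefan_solution q L0 Tm0 (explicit_T q L0 \<gamma>) (explicit_S \<gamma>) \<and>
       (\<forall>T S. stefan_solution q L0 Tm0 T S \<longrightarrow>
          (\<forall>t\<ge>0. S t = explicit_S \<gamma> t) \<and>
          (\<forall>t\<ge>0. \<forall>y. 0 \<le> y \<and> y \<le> S t \<longrightarrow> T y t = explicit_T q L0 \<gamma> y t))"
    using explicit_solution unique by blast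
qed

end
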